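(* Let $\mathcal{A}$ be a C*-algebra and $a\in\mathcal{A}^+$. The map $f\mapsto\|f\|_a:=\|a^{1/2}fa^{1/2}\|$ is a norm on $\mathcal{A}^*$ if and only if $\varphi(a)>0$ for every nonzero positive continuous linear functional $\varphi$ on $\mathcal{A}$.
   Context: For $f\in\mathcal{A}^*$, $a^{1/2}fa^{1/2}$ is the functional $x\mapsto f(a^{1/2}xa^{1/2})$, and $\|\cdot\|$ is the norm of $\mathcal{A}^*$. *)

theory Defs
  imports "HOL-Analysis.Analysis"
begin

class complex_vector = real_vector +
  fixes scaleC :: "complex \<Rightarrow> 'a \<Rightarrow> 'a"
  assumes scaleC_add_right: "scaleC c (x + y) = scaleC c x + scaleC c y"
    and scaleC_add_left: "scaleC (c + d) x = scaleC c x + scaleC d x"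
    and scaleC_scaleC: "scaleC c (scaleC d x) = scaleC (c * d) x"
    and scaleC_one: "scaleC 1 x = x"
    and scaleR_scaleC: "scaleR r x = scaleC (complex_of_real r) x"

class complex_normed_vector = complex_vector + real_normed_vector +
  assumes norm_scaleC: "norm (scaleC c x) = cmod c * norm x"

class complex_normed_algebra = complex_normed_vector + real_normed_algebra +
  assumes scaleC_mult_left: "scaleC c x * y = scaleC c (x * y)"
    and scaleC_mult_right: "x * scaleC c y = scaleC c (x * y)"

class cstar_algebra = complex_normed_algebra + banach +
  fixes adj :: "'a \<Rightarrow> 'a"
  assumes adj_adj: "adj (adj x) = x"
    and adj_add: "adj (x + y) = adj x + adj y"
    and adj_mult: "adj (x * y) = adj y * adj x"
    and adj_scaleC: "adj (scaleC c x) = scaleC (cnj c) (adj x)"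
    and cstar_identity: "norm (adj x * x) = (norm x)\<^sup>2"

definition positive :: "'a::cstar_algebra \<Rightarrow> bool" where
  "positive a \<longleftrightarrow> (\<exists>b. a = adj b * b)"

definition pos_sqrt :: "'a::cstar_algebra \<Rightarrow> 'a" where
  "pos_sqrt a = (THE r. positive r \<and> r * r = a)"

definition clinear_functional :: "('a::complex_vector \<Rightarrow> complex) \<Rightarrow> bool" where
  "clinear_functional f \<longleftrightarrow>
     (\<forall>x y. f (x + y) = f x + f y) \<and> (\<forall>c x. f (scaleC c x) = c * f x)"

definition cdual :: "('a::complex_normed_vector \<Rightarrow> complex) set" where
  "cdual = {f. clinear_functional f \<and> continuous_on UNIV f}"

definition dual_norm :: "('a::complex_normed_vector \<Rightarrow> complex) \<Rightarrow> real" where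
  "dual_norm f = Sup {cmod (f x) | x. norm x \<le> 1}"

definition is_norm_on ::
  "('a \<Rightarrow> complex) set \<Rightarrow> (('a \<Rightarrow> complex) \<Rightarrow> real) \<Rightarrow> bool" where
  "is_norm_on V N \<longleftrightarrow>
     (\<forall>f\<in>V. 0 \<le> N f) \<and>
     (\<forall>f\<in>V. \<forall>g\<in>V. N (\<lambda>x. f x + g x) \<le> N f + N g) \<and>
     (\<forall>f\<in>V. \<forall>c. N (\<lambda>x. c * f x) = cmod c * N f) \<and>
     (\<forall>f\<in>V. N f = 0 \<longrightarrow> f = (\<lambda>x. 0))"

definition positive_functional :: "('a::cstar_algebra \<Rightarrow> complex) \<Rightarrow> bool" where
  "positive_functional \<phi> \<longleftrightarrow>
     \<phi> \<in> cdual \<and> (\<forall>b. positive b \<longrightarrow> Im (\<phi> b) = 0 \<and> 0 \<le> Re (\<phi> b))"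

end

theory Submission
  imports Defs
begin

text \<open>
  With \<open>r = a\<^sup>1\<^sup>/\<^sup>2\<close> the map is a norm iff no nonzero functional vanishes on \<open>rAr\<close>. A positive \<open>\<phi>\<close> with
  \<open>\<phi>(a) = 0\<close> vanishes there by Cauchy--Schwarz, which gives one direction. Conversely, if no nonzero
  positive functional kills \<open>a\<close>, a Hahn--Banach argument shows that for every positive \<open>b\<close> and \<open>\<epsilon> > 0\<close> there
  is \<open>t\<close> with \<open>b \<le> \<epsilon> + t a\<close> in the unitization. Taking \<open>b = x\<^sup>* x\<close> and \<open>d\<^sub>k = (1 - a/M)\<^sup>k\<close>
  with \<open>M > \<parallel>a\<parallel>\<close>, this forces \<open>x d\<^sub>k \<rightarrow> 0\<close>, so that \<open>(1 - d\<^sub>k) x (1 - d\<^sub>k) \<rightarrow> x\<close>. These elements lie in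
  \<open>rAr\<close>, which is therefore dense.

  The required C*-theory (unique positive square roots, positivity of \<open>b\<^sup>* b\<close>) is obtained without spectra, from
  a norm-convergent iteration for \<open>sqrt (1 - x)\<close> and the estimate \<open>\<parallel>u\<parallel>\<^sup>2 \<le> \<parallel>u\<^sup>2 + v\<^sup>2\<parallel>\<close> for commuting
  selfadjoint \<open>u\<close>, \<open>v\<close>.
\<close>

section \<open>The involution\<close>

lemma scaleC_minus_one: "scaleC (-1) x = - (x::'a::complex_vector)"
  using scaleR_scaleC[of "-1" x] by simp

lemma adj_scaleR: "adj (r *\<^sub>R x) = r *\<^sub>R adj (x::'a::cstar_algebra)"
  by (simp add: scaleR_scaleC adj_scaleC)

lemma adj_zero [simp]: "adj (0::'a::cstar_algebra) = 0"
  using adj_scaleR[of 0 0] by simp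

lemma adj_minus: "adj (- x) = - adj (x::'a::cstar_algebra)"
  using adj_scaleR[of "-1" x] by simp

lemma adj_diff: "adj (x - y) = adj x - adj (y::'a::cstar_algebra)"
  using adj_add[of x "- y"] by (simp add: adj_minus)

lemma adj_one [simp]: "adj (1::'a::{cstar_algebra,real_normed_algebra_1}) = 1"
  by (metis adj_adj adj_mult mult.right_neutral)

text \<open>The C*-identity and submultiplicativity bound the square of \<open>norm y\<close> by
  \<open>norm (adj y) * norm y\<close>. Cancelling gives one inequality; the other is the same one
  at \<open>adj x\<close>.\<close>

lemma norm_adj [simp]: "norm (adj x) = norm (x::'a::cstar_algebra)"
proof -
  have le: "norm y \<le> norm (adj y)" for y :: 'a
  proof (cases "norm y = 0")
    case False
    have "norm y * norm y \<le> norm (adj y) * norm y"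
      using norm_mult_ineq[of "adj y" y] by (simp add: cstar_identity power2_eq_square)
    then show ?thesis using False by simp
  qed simp
  show ?thesis using le[of x] le[of "adj x"] by (simp add: adj_adj)
qed

lemma bounded_linear_adj: "bounded_linear (adj :: 'a::cstar_algebra \<Rightarrow> 'a)"
  by (rule bounded_linear_intro[of _ 1]) (simp_all add: adj_add adj_scaleR)

lemma norm_selfadjoint_square:
  "adj x = x \<Longrightarrow> norm (x * x) = (norm (x::'a::cstar_algebra))\<^sup>2"
  using cstar_identity[of x] by simp

lemma selfadjoint_square_eq_0: "adj x = x \<Longrightarrow> x * x = 0 \<Longrightarrow> x = (0::'a::cstar_algebra)"
  using norm_selfadjoint_square[of x] by simp

lemma adj_mult_self_eq_0: "adj x * x = 0 \<Longrightarrow> x = (0::'a::cstar_algebra)"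
  using cstar_identity[of x] by simp

lemma scaleC_zero_left [simp]: "scaleC 0 x = (0::'a::complex_vector)"
  using scaleR_scaleC[of 0 x] by simp

lemma scaleC_zero_right [simp]: "scaleC c (0::'a::complex_vector) = 0"
  using scaleC_add_right[of c 0 0] by simp

lemma scaleC_minus_right: "scaleC c (- x) = - scaleC c (x::'a::complex_vector)"
  using scaleC_add_right[of c x "- x"] by (simp add: eq_neg_iff_add_eq_0 add.commute)

lemma scaleC_diff_right: "scaleC c (x - y) = scaleC c x - scaleC c (y::'a::complex_vector)"
  using scaleC_add_right[of c x "- y"] by (simp add: scaleC_minus_right)

text \<open>With \<open>w = u + \<i>v\<close> one has \<open>w\<^sup>* w = u\<^sup>2 + v\<^sup>2\<close> and \<open>2u = w + w\<^sup>*\<close>.\<close>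

lemma norm_square_le_sum_squares:
  fixes u v :: "'a::cstar_algebra"
  assumes "adj u = u" "adj v = v" "u * v = v * u"
  shows "(norm u)\<^sup>2 \<le> norm (u * u + v * v)"
proof -
  define w where "w = u + scaleC \<i> v"
  have aw: "adj w = u - scaleC \<i> v"
    using assms scaleC_scaleC[of "-1" "\<i>" v] by (simp add: w_def adj_add adj_scaleC scaleC_minus_one)
  have "adj w * w = u * u + v * v"
    using assms(3)
    by (simp add: aw, simp add: w_def algebra_simps scaleC_mult_left scaleC_mult_right scaleC_scaleC
        scaleC_diff_right scaleC_minus_one)
  then have nw: "norm (u * u + v * v) = (norm w)\<^sup>2" by (metis cstar_identity)
  have "w + adj w = 2 *\<^sub>R u" by (simp add: aw, simp add: w_def scaleR_2)
  then have "2 * norm u \<le> norm w + norm (adj w)"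
    using norm_triangle_ineq[of w "adj w"] by simp
  then show ?thesis unfolding nw by (simp add: power_mono)
qed

section \<open>Square roots in a unital algebra\<close>

text \<open>The Visser iteration for \<open>1 - sqrt (1 - x)\<close>. Its increments are dominated in norm by those of
  the scalar iteration at \<open>x = 1\<close>, which increases to 1.\<close>

primrec sqrt_iter :: "'a::real_normed_algebra_1 \<Rightarrow> nat \<Rightarrow> 'a" where
  "sqrt_iter x 0 = 0"
| "sqrt_iter x (Suc n) = (1/2) *\<^sub>R (x + sqrt_iter x n * sqrt_iter x n)"

lemma sqrt_iter_one_bounds:
  "0 \<le> sqrt_iter (1::real) n \<and> sqrt_iter (1::real) n \<le> 1 \<and> sqrt_iter (1::real) n \<le> sqrt_iter 1 (Suc n)"
proof (induction n)
  case (Suc n)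
  let ?e = "sqrt_iter (1::real) n" and ?f = "sqrt_iter (1::real) (Suc n)"
  have "?e * ?e \<le> 1 * 1" using Suc by (intro mult_mono) auto
  moreover have "?e * ?e \<le> ?f * ?f" using Suc by (intro mult_mono) auto
  ultimately show ?case using Suc by simp
qed simp

text \<open>Each iterate is a fixed real polynomial in its argument, and an intertwining relation
  passes to polynomials. Two arguments are kept apart because \<open>adj b * b\<close> and
  \<open>b * adj b\<close> are compared later.\<close>

lemma sqrt_iter_intertwine:
  fixes x :: "'a::real_normed_algebra_1"
  assumes "x * b = b * z"
  shows "sqrt_iter x k * b = b * sqrt_iter z k"
proof (induction k)
  case (Suc k)
  then have "sqrt_iter x k * (sqrt_iter x k * b) = b * (sqrt_iter z k * sqrt_iter z k)"
    by (metis mult.assoc)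
  with assms show ?case by (simp add: algebra_simps)
qed simp

lemma sqrt_iter_commute:
  "sqrt_iter x m * sqrt_iter x n = sqrt_iter x n * sqrt_iter (x::'a::real_normed_algebra_1) m"
  by (intro sqrt_iter_intertwine sym[OF sqrt_iter_intertwine] refl)

lemma norm_sqrt_iter_le:
  assumes "norm (x::'a::real_normed_algebra_1) \<le> 1"
  shows "norm (sqrt_iter x n) \<le> sqrt_iter 1 n"
proof (induction n)
  case (Suc n)
  have "norm (sqrt_iter x n * sqrt_iter x n) \<le> sqrt_iter 1 n * sqrt_iter 1 n"
    using Suc by (intro order_trans[OF norm_mult_ineq] mult_mono) (auto simp: sqrt_iter_one_bounds)
  then show ?case using assms norm_triangle_ineq[of x "sqrt_iter x n * sqrt_iter x n"] by simp
qed simp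

text \<open>Iterates commute, so each new increment is half of \<open>(?z - ?y) * (?z + ?y)\<close>,
  and both factors are dominated by their scalar counterparts.\<close>

lemma norm_sqrt_iter_step_le:
  fixes x :: "'a::real_normed_algebra_1"
  assumes "norm x \<le> 1"
  shows "norm (sqrt_iter x (Suc n) - sqrt_iter x n) \<le> sqrt_iter 1 (Suc n) - sqrt_iter 1 n"
proof (induction n)
  case (Suc n)
  let ?y = "sqrt_iter x n" and ?z = "sqrt_iter x (Suc n)"
  let ?e = "sqrt_iter (1::real) n" and ?f = "sqrt_iter (1::real) (Suc n)"
  have c: "?y * ?z = ?z * ?y" by (rule sqrt_iter_commute)
  have "sqrt_iter x (Suc (Suc n)) - ?z = (1/2) *\<^sub>R (?z * ?z - ?y * ?y)"
    by (subst (1 2) sqrt_iter.simps(2)) (simp add: algebra_simps)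
  also have "?z * ?z - ?y * ?y = (?z - ?y) * (?z + ?y)"
    using c by (simp only: ring_distribs) simp
  finally have eq: "sqrt_iter x (Suc (Suc n)) - ?z = (1/2) *\<^sub>R ((?z - ?y) * (?z + ?y))" .
  have nn: "norm (?z + ?y) \<le> ?f + ?e"
    using norm_triangle_ineq[of ?z ?y] norm_sqrt_iter_le[OF assms, of n]
      norm_sqrt_iter_le[OF assms, of "Suc n"] by linarith
  have "norm ((?z - ?y) * (?z + ?y)) \<le> (?f - ?e) * (?f + ?e)"
  proof -
    have "norm ((?z - ?y) * (?z + ?y)) \<le> norm (?z - ?y) * norm (?z + ?y)"
      by (rule norm_mult_ineq)
    also have "\<dots> \<le> (?f - ?e) * (?f + ?e)"
      using Suc.IH nn sqrt_iter_one_bounds[of n] by (intro mult_mono) auto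
    finally show ?thesis .
  qed
  moreover have "sqrt_iter 1 (Suc (Suc n)) - ?f = (?f - ?e) * (?f + ?e) / 2"
    by (subst (1 2) sqrt_iter.simps(2)) (simp add: field_simps)
  ultimately show ?case unfolding eq by simp
qed (use assms in simp)

text \<open>The increments are absolutely summable: the dominating scalar increments telescope to a
  finite limit.\<close>

lemma convergent_sqrt_iter:
  fixes x :: "'a::{real_normed_algebra_1,banach}"
  assumes "norm x \<le> 1"
  shows "convergent (sqrt_iter x)"
proof -
  let ?e = "sqrt_iter (1::real)"
  have "incseq ?e" using sqrt_iter_one_bounds by (intro incseq_SucI) blast
  then obtain l where "?e \<longlonglongrightarrow> l"
    using incseq_convergent[of ?e 1] sqrt_iter_one_bounds by blast
  then have "summable (\<lambda>n. ?e (Suc n) - ?e n)" by (rule telescope_summable)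
  then have "summable (\<lambda>n. sqrt_iter x (Suc n) - sqrt_iter x n)"
    by (rule summable_comparison_test'[where N=0]) (rule norm_sqrt_iter_step_le[OF assms])
  then have "convergent (\<lambda>n. \<Sum>k<n. sqrt_iter x (Suc k) - sqrt_iter x k)"
    by (simp add: summable_iff_convergent)
  then show ?thesis by (simp only: sum_lessThan_telescope) simp
qed

text \<open>This is \<open>1 - sqrt (1 - x)\<close>, so the root of \<open>1 - x\<close> is
  \<open>1 - sqrt_compl x\<close>.\<close>

definition sqrt_compl :: "'a::{real_normed_algebra_1,banach} \<Rightarrow> 'a" where
  "sqrt_compl x = lim (sqrt_iter x)"

context
  fixes x :: "'a::{cstar_algebra,real_normed_algebra_1}"
  assumes x: "norm x \<le> 1"
begin

lemma sqrt_iter_tendsto: "sqrt_iter x \<longlonglongrightarrow> sqrt_compl x"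
  using convergent_sqrt_iter[OF x] by (simp add: sqrt_compl_def convergent_LIMSEQ_iff)

lemma norm_sqrt_compl_le: "norm (sqrt_compl x) \<le> 1"
proof -
  have "norm (sqrt_iter x n) \<le> 1" for n
    using norm_sqrt_iter_le[OF x, of n] sqrt_iter_one_bounds[of n] by linarith
  then show ?thesis
    using tendsto_norm[OF sqrt_iter_tendsto] by (auto intro: LIMSEQ_le_const2)
qed

text \<open>Passing to the limit in the recursion gives a quadratic equation for
  \<open>sqrt_compl x\<close>; complete the square.\<close>

lemma sqrt_compl_square: "(1 - sqrt_compl x) * (1 - sqrt_compl x) = 1 - x"
proof -
  have "(\<lambda>n. sqrt_iter x (Suc n)) \<longlonglongrightarrow> (1/2) *\<^sub>R (x + sqrt_compl x * sqrt_compl x)"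
    unfolding sqrt_iter.simps by (intro tendsto_intros sqrt_iter_tendsto)
  moreover have "(\<lambda>n. sqrt_iter x (Suc n)) \<longlonglongrightarrow> sqrt_compl x"
    by (rule LIMSEQ_Suc[OF sqrt_iter_tendsto])
  ultimately have "sqrt_compl x = (1/2) *\<^sub>R (x + sqrt_compl x * sqrt_compl x)"
    using LIMSEQ_unique by blast
  then have "2 *\<^sub>R sqrt_compl x = x + sqrt_compl x * sqrt_compl x"
    by (metis eq_vector_fraction_iff scaleR_one zero_neq_numeral)
  then show ?thesis by (simp add: algebra_simps scaleR_2)
qed

lemma sqrt_compl_selfadjoint:
  assumes "adj x = x"
  shows "adj (sqrt_compl x) = sqrt_compl x"
proof -
  have "adj (sqrt_iter x n) = sqrt_iter x n" for n
    by (induction n) (simp_all add: adj_scaleR adj_add adj_mult assms)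
  then show ?thesis
    using bounded_linear.tendsto[OF bounded_linear_adj sqrt_iter_tendsto] sqrt_iter_tendsto
    by (simp add: LIMSEQ_unique)
qed

end

lemma sqrt_compl_intertwine:
  fixes x z :: "'a::{cstar_algebra,real_normed_algebra_1}"
  assumes "norm x \<le> 1" "norm z \<le> 1" "x * b = b * z"
  shows "sqrt_compl x * b = b * sqrt_compl z"
proof -
  have "(\<lambda>n. sqrt_iter x n * b) \<longlonglongrightarrow> sqrt_compl x * b"
    by (intro tendsto_intros sqrt_iter_tendsto assms)
  moreover have "(\<lambda>n. b * sqrt_iter z n) \<longlonglongrightarrow> b * sqrt_compl z"
    by (intro tendsto_intros sqrt_iter_tendsto assms)
  ultimately show ?thesis
    using LIMSEQ_unique by (simp add: sqrt_iter_intertwine[OF assms(3)])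
qed

section \<open>Squares of selfadjoint elements\<close>

text \<open>A form of positivity that makes sense without unit or spectrum. Its agreement with
  \<open>positive\<close> rests on the positivity of \<open>adj b * b\<close> and is reached through
  the unitization.\<close>

definition psd :: "'a::cstar_algebra \<Rightarrow> bool" where
  "psd h \<longleftrightarrow> (\<exists>s. adj s = s \<and> s * s = h)"

lemma psd_selfadjoint: "psd h \<Longrightarrow> adj h = h"
  by (auto simp: psd_def adj_mult)

lemma psd_square: "adj s = s \<Longrightarrow> psd (s * s)"
  by (auto simp: psd_def)

lemma psd_zero [simp]: "psd 0"
  using psd_square[of 0] by simp

lemma psd_scaleR: "0 \<le> t \<Longrightarrow> psd h \<Longrightarrow> psd (t *\<^sub>R h)"
proof -
  assume t: "0 \<le> t" and "psd h"
  then obtain s where s: "adj s = s" "s * s = h" by (auto simp: psd_def)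
  have "(sqrt t *\<^sub>R s) * (sqrt t *\<^sub>R s) = t *\<^sub>R h" using t s by simp
  moreover have "adj (sqrt t *\<^sub>R s) = sqrt t *\<^sub>R s" using s by (simp add: adj_scaleR)
  ultimately show ?thesis unfolding psd_def by blast
qed

text \<open>The root \<open>r\<close> of \<open>1 - h\<close> commutes with the root
  \<open>s\<close> of \<open>h\<close>, and \<open>r * r + s * s = 1\<close>; the sum-of-squares
  estimate bounds \<open>r\<close>.\<close>

lemma norm_one_minus_psd_le:
  fixes h :: "'a::{cstar_algebra,real_normed_algebra_1}"
  assumes "psd h" "norm h \<le> 1"
  shows "norm (1 - h) \<le> 1"
proof -
  obtain s where s: "adj s = s" "s * s = h" using assms(1) by (auto simp: psd_def)
  define r where "r = 1 - sqrt_compl h"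
  have rr: "r * r = 1 - h" unfolding r_def by (rule sqrt_compl_square[OF assms(2)])
  have ar: "adj r = r"
    using sqrt_compl_selfadjoint[OF assms(2) psd_selfadjoint[OF assms(1)]]
    by (simp add: r_def adj_diff)
  have "sqrt_compl h * s = s * sqrt_compl h"
    using s by (intro sqrt_compl_intertwine assms) (auto simp: mult.assoc)
  then have "r * s = s * r" by (simp add: r_def algebra_simps)
  then have "(norm r)\<^sup>2 \<le> 1"
    using norm_square_le_sum_squares[OF ar s(1)] by (simp add: rr s(2))
  then show ?thesis using norm_selfadjoint_square[OF ar] by (simp add: rr)
qed

text \<open>The iteration at \<open>1 - h\<close> converges and yields a selfadjoint root of
  \<open>h\<close>.\<close>

lemma psd_if_norm_one_minus_le:
  fixes h :: "'a::{cstar_algebra,real_normed_algebra_1}"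
  assumes "adj h = h" "norm (1 - h) \<le> 1"
  shows "psd h"
  using sqrt_compl_square[OF assms(2)] sqrt_compl_selfadjoint[OF assms(2)] assms(1)
  unfolding psd_def by (intro exI[of _ "1 - sqrt_compl (1 - h)"]) (simp add: adj_diff)

lemma psd_scaleR_cancel:
  fixes h :: "'a::cstar_algebra"
  assumes "0 < t" "psd (t *\<^sub>R h)"
  shows "psd h"
  using psd_scaleR[of "inverse t" "t *\<^sub>R h"] assms by simp

text \<open>After scaling into the unit ball, positivity amounts to the convex condition
  \<open>norm (1 - h) \<le> 1\<close>, which passes to the midpoint.\<close>

lemma psd_add:
  fixes h k :: "'a::{cstar_algebra,real_normed_algebra_1}"
  assumes h: "psd h" and k: "psd k"
  shows "psd (h + k)"
proof -
  \<comment> \<open>The summand 1 keeps \<open>t\<close> positive when both elements vanish.\<close>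
  define t where "t = norm h + norm k + 1"
  have t: "0 < t" "norm h \<le> t" "norm k \<le> t"
    by (simp_all add: t_def add_nonneg_pos)
  define h' k' where "h' = (1/t) *\<^sub>R h" and "k' = (1/t) *\<^sub>R k"
  have "norm (1 - h') \<le> 1" "norm (1 - k') \<le> 1"
    using t h k by (auto simp: h'_def k'_def field_simps intro!: norm_one_minus_psd_le psd_scaleR)
  moreover have "1 - (1/2) *\<^sub>R (h' + k') = (1/2) *\<^sub>R ((1 - h') + (1 - k'))"
    using scaleR_half_double[of "1::'a"] by (simp add: algebra_simps)
  ultimately have "norm (1 - (1/2) *\<^sub>R (h' + k')) \<le> 1"
    using norm_triangle_ineq[of "1 - h'" "1 - k'"] by simp
  then have "psd ((1/2) *\<^sub>R (h' + k'))"
    using psd_selfadjoint[OF h] psd_selfadjoint[OF k]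
    by (intro psd_if_norm_one_minus_le) (simp_all add: h'_def k'_def adj_add adj_scaleR)
  then have "psd ((1/(2*t)) *\<^sub>R (h + k))" by (simp add: h'_def k'_def scaleR_right_distrib)
  then show ?thesis by (rule psd_scaleR_cancel[rotated]) (use t in simp)
qed

lemma psd_norm_minus:
  fixes h :: "'a::{cstar_algebra,real_normed_algebra_1}"
  assumes "adj h = h" "norm h \<le> t"
  shows "psd (t *\<^sub>R 1 - h)"
proof (cases "t = 0")
  case False
  then have t: "0 < t" using assms(2) norm_ge_zero[of h] by linarith
  have "psd (1 - (1/t) *\<^sub>R h)"
    using t assms by (intro psd_if_norm_one_minus_le) (auto simp: adj_diff adj_scaleR)
  then show ?thesis using psd_scaleR[of t "1 - (1/t) *\<^sub>R h"] t by (simp add: algebra_simps)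
qed (use assms in simp)

section \<open>Existence, commutation and uniqueness of positive square roots\<close>

lemma psd_sqrt_intertwine:
  fixes h g :: "'a::{cstar_algebra,real_normed_algebra_1}"
  assumes h: "psd h" and g: "psd g"
  shows "\<exists>r s. psd r \<and> r * r = h \<and> psd s \<and> s * s = g \<and> (\<forall>b. h * b = b * g \<longrightarrow> r * b = b * s)"
proof -
  \<comment> \<open>One scaling factor serves both elements, so that both roots are limits of the
    same polynomials and \<open>b\<close> intertwines them.\<close>
  define t where "t = norm h + norm g + 1"
  have t: "0 < t" "norm h \<le> t" "norm g \<le> t"
    by (simp_all add: t_def add_nonneg_pos)
  define rt where "rt k = sqrt t *\<^sub>R (1 - sqrt_compl (1 - (1/t) *\<^sub>R k))" for k :: 'a
  have n: "norm (1 - (1/t) *\<^sub>R k) \<le> 1" if "psd k" "norm k \<le> t" for k :: 'a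
    using t(1) that by (intro norm_one_minus_psd_le psd_scaleR) auto
  have sq: "rt k * rt k = k" if "psd k" "norm k \<le> t" for k :: 'a
    using t(1) sqrt_compl_square[OF n[OF that]] by (simp add: rt_def)
  have pos: "psd (rt k)" if "psd k" "norm k \<le> t" for k :: 'a
    unfolding rt_def
    using t(1) norm_sqrt_compl_le[OF n[OF that]] sqrt_compl_selfadjoint[OF n[OF that]]
      psd_selfadjoint[OF that(1)]
    by (intro psd_scaleR psd_if_norm_one_minus_le) (auto simp: adj_diff adj_scaleR)
  have "rt h * b = b * rt g" if "h * b = b * g" for b
  proof -
    have "sqrt_compl (1 - (1/t) *\<^sub>R h) * b = b * sqrt_compl (1 - (1/t) *\<^sub>R g)"
      using that by (intro sqrt_compl_intertwine n h g t) (simp add: algebra_simps)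
    then show ?thesis by (simp add: rt_def algebra_simps)
  qed
  then show ?thesis using sq pos h g t by blast
qed

lemma psd_sqrt_commute:
  fixes h :: "'a::{cstar_algebra,real_normed_algebra_1}"
  assumes "psd h"
  obtains s where "psd s" "s * s = h" "\<And>b. h * b = b * h \<Longrightarrow> s * b = b * s"
proof -
  obtain r s where rs: "psd r" "r * r = h" "psd s" "s * s = h"
    "\<And>b. h * b = b * h \<Longrightarrow> r * b = b * s"
    using psd_sqrt_intertwine[OF assms assms] by blast
  \<comment> \<open>Intertwining by 1 identifies the two roots.\<close>
  from rs(5)[of 1] have "r = s" by simp
  with rs that show thesis by blast
qed

text \<open>Any root \<open>q\<close> is compared with the root \<open>s\<close> commuting with
  everything that commutes with the square. For \<open>d = q - s\<close>, the elements
  \<open>q * d * d\<close> and \<open>s * d * d\<close> are commuting squares with sum 0, so both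
  vanish.\<close>

lemma psd_sqrt_unique:
  fixes r r' :: "'a::{cstar_algebra,real_normed_algebra_1}"
  assumes r: "psd r" and r': "psd r'" and eq: "r * r = r' * r'"
  shows "r = r'"
proof -
  have sa: "adj r = r" "adj r' = r'" using r r' by (auto dest: psd_selfadjoint)
  obtain s where s: "psd s" "s * s = r * r" "\<And>b. r * r * b = b * (r * r) \<Longrightarrow> s * b = b * s"
    using psd_sqrt_commute[OF psd_square[OF sa(1)]] by blast
  have main: "q = s" if q: "psd q" "q * q = r * r" for q
  proof -
    \<comment> \<open>\<open>q\<close> commutes with its own square, hence with
      \<open>s\<close>.\<close>
    have sq: "s * q = q * s" using q by (intro s(3)) (metis mult.assoc)
    obtain k where k: "psd k" "k * k = q" "\<And>b. q * b = b * q \<Longrightarrow> k * b = b * k"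
      using psd_sqrt_commute[OF q(1)] by blast
    obtain l where l: "psd l" "l * l = s" "\<And>b. s * b = b * s \<Longrightarrow> l * b = b * l"
      using psd_sqrt_commute[OF s(1)] by blast
    define d where "d = q - s"
    have ad: "adj d = d" using q(1) s(1) by (simp add: d_def adj_diff psd_selfadjoint)
    have kd: "k * d = d * k" using sq by (intro k(3)) (simp add: d_def algebra_simps)
    have ld: "l * d = d * l" using sq by (intro l(3)) (simp add: d_def algebra_simps)
    have lk: "l * k = k * l" using k(3)[of s] sq by (intro l(3)) metis
    have a: "adj (k * d) = k * d" "adj (l * d) = l * d"
      using kd ld ad k(1) l(1) by (simp_all add: adj_mult psd_selfadjoint)
    have "k * (d * l) * d = l * (d * k) * d"
      unfolding kd[symmetric] ld[symmetric] by (simp only: lk flip: mult.assoc)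
    then have c: "(k * d) * (l * d) = (l * d) * (k * d)" by (simp only: mult.assoc)
    have sqs: "(k * d) * (k * d) = q * d * d" "(l * d) * (l * d) = s * d * d"
      using kd ld k(2) l(2) by (metis mult.assoc)+
    have "q * d * d + s * d * d = (q + s) * (q - s) * d"
      by (simp add: d_def algebra_simps)
    also have "(q + s) * (q - s) = 0" using sq q(2) s(2) by (simp add: algebra_simps)
    finally have z: "(k * d) * (k * d) + (l * d) * (l * d) = 0" unfolding sqs by simp
    have "k * d = 0"
      using norm_square_le_sum_squares[OF a c] z by simp
    moreover have "l * d = 0"
      using norm_square_le_sum_squares[OF a(2,1) c[symmetric]] z by (simp add: add.commute)
    ultimately have "q * d = 0" "s * d = 0" using k(2) l(2) by (metis mult.assoc mult_zero_right)+
    then have "d * d = 0" by (simp add: d_def left_diff_distrib)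
    then show ?thesis using selfadjoint_square_eq_0[OF ad] by (simp add: d_def)
  qed
  show ?thesis using main[OF r refl] main[OF r' eq[symmetric]] by simp
qed

section \<open>Properness of the positive cone, and positivity of \<open>adj b * b\<close>\<close>

lemma psd_antisym:
  fixes p :: "'a::{cstar_algebra,real_normed_algebra_1}"
  assumes "psd p" "psd (- p)"
  shows "p = 0"
proof -
  \<comment> \<open>Both are positive roots of the same square.\<close>
  have "p = - p" by (rule psd_sqrt_unique[OF assms]) simp
  then have "2 *\<^sub>R p = 0" by (metis add.right_inverse scaleR_2)
  then show ?thesis by simp
qed

lemma psd_add_eq_0:
  fixes p q :: "'a::{cstar_algebra,real_normed_algebra_1}"
  assumes "psd p" "psd q" "p + q = 0"
  shows "p = 0"
proof -
  have "- p = q" using assms(3) by (simp add: neg_eq_iff_add_eq_0)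
  then show ?thesis using assms by (intro psd_antisym) auto
qed

text \<open>A root \<open>k\<close> of \<open>p\<close> commutes with \<open>m\<close>, so the
  conjugate is the square of the selfadjoint element \<open>k * m\<close>.\<close>

lemma psd_commuting_conjugate:
  fixes p m :: "'a::{cstar_algebra,real_normed_algebra_1}"
  assumes "psd p" "adj m = m" "p * m = m * p"
  shows "psd (m * p * m)" "m * p * m = 0 \<Longrightarrow> p * m = 0"
proof -
  obtain k where k: "psd k" "k * k = p" "\<And>b. p * b = b * p \<Longrightarrow> k * b = b * k"
    using psd_sqrt_commute[OF assms(1)] by blast
  have km: "k * m = m * k" using assms k by blast
  have a: "adj (k * m) = k * m" using km k(1) assms by (simp add: adj_mult psd_selfadjoint)
  have e: "m * p * m = (k * m) * (k * m)" using km k(2) by (metis mult.assoc)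
  show "psd (m * p * m)" unfolding e by (rule psd_square[OF a])
  show "p * m = 0" if "m * p * m = 0"
    using selfadjoint_square_eq_0[OF a] that k(2) unfolding e by (metis mult.assoc mult_zero_right)
qed

text \<open>Up to the factor 2 this is the sum of the squares of the selfadjoint elements
  \<open>x + adj x\<close> and \<open>scaleC \<i> (x - adj x)\<close>.\<close>

lemma adj_mult_self_plus_psd:
  fixes x :: "'a::{cstar_algebra,real_normed_algebra_1}"
  shows "psd (adj x * x + x * adj x)"
proof -
  define u v where "u = x + adj x" and "v = scaleC \<i> (x - adj x)"
  have a: "adj u = u" by (simp add: u_def adj_add adj_adj add.commute)
  have "adj v = scaleC (-1) (scaleC \<i> (adj x - x))"
    by (simp add: v_def adj_scaleC adj_diff adj_adj scaleC_scaleC)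
  then have b: "adj v = v" by (simp add: scaleC_minus_one v_def flip: scaleC_minus_right)
  have "u * u + v * v = 2 *\<^sub>R (adj x * x + x * adj x)"
    by (simp add: u_def v_def scaleC_mult_left scaleC_mult_right scaleC_scaleC scaleC_minus_one
        scaleC_diff_right scaleR_2 algebra_simps)
  then have "psd (2 *\<^sub>R (adj x * x + x * adj x))"
    using psd_add[OF psd_square[OF a] psd_square[OF b]] by simp
  then show ?thesis by (rule psd_scaleR_cancel[rotated]) simp
qed

text \<open>With \<open>h = b\<^sup>* b\<close>, \<open>g = b b\<^sup>*\<close>, the negative parts \<open>m = |h| - h\<close> and \<open>n = |g| - g\<close> satisfy
  \<open>b m = n b =: x\<close>, whence both \<open>x\<^sup>* x = - m |h| m\<close> and \<open>x x\<^sup>* = - n |g| n\<close> are negative. As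
  \<open>x\<^sup>* x + x x\<^sup>*\<close> is always positive, \<open>x = 0\<close>.\<close>

lemma psd_adj_mult_self:
  fixes b :: "'a::{cstar_algebra,real_normed_algebra_1}"
  shows "psd (adj b * b)"
proof -
  define h g where "h = adj b * b" and "g = b * adj b"
  have sa: "adj h = h" "adj g = g" by (simp_all add: h_def g_def adj_mult adj_adj)
  obtain H where H: "psd H" "H * H = h * h" "\<And>c. h * h * c = c * (h * h) \<Longrightarrow> H * c = c * H"
    using psd_sqrt_commute[OF psd_square[OF sa(1)]] by blast
  obtain G where G: "psd G" "G * G = g * g" "\<And>c. g * g * c = c * (g * g) \<Longrightarrow> G * c = c * G"
    using psd_sqrt_commute[OF psd_square[OF sa(2)]] by blast
  \<comment> \<open>The intertwining property comes with its own pair of roots; uniqueness then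
    identifies them with \<open>G\<close> and \<open>H\<close>.\<close>
  obtain G' H' where GH: "psd G'" "G' * G' = g * g" "psd H'" "H' * H' = h * h"
    "\<And>c. g * g * c = c * (h * h) \<Longrightarrow> G' * c = c * H'"
    using psd_sqrt_intertwine[OF psd_square[OF sa(2)] psd_square[OF sa(1)]] by blast
  have eqs: "G' = G" "H' = H" using psd_sqrt_unique GH G(1,2) H(1,2) by metis+
  have gb: "g * b = b * h" by (simp add: g_def h_def mult.assoc)
  then have Gb: "G * b = b * H" using GH(5)[of b] unfolding eqs by (metis mult.assoc)
  define m n where "m = H - h" and "n = G - g"
  define x where "x = b * m"
  have am: "adj m = m" and an: "adj n = n"
    using sa H(1) G(1) by (simp_all add: m_def n_def adj_diff psd_selfadjoint)
  have Hh: "H * h = h * H" by (rule H(3)) (simp add: mult.assoc)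
  have Gg: "G * g = g * G" by (rule G(3)) (simp add: mult.assoc)
  have Hm: "H * m = m * H" using Hh by (simp add: m_def algebra_simps)
  have Gn: "G * n = n * G" using Gg by (simp add: n_def algebra_simps)
  have hm: "h * m = - (H * m)" using Hh H(2) by (simp add: m_def algebra_simps)
  have gn: "g * n = - (G * n)" using Gg G(2) by (simp add: n_def algebra_simps)
  have xn: "x = n * b" using Gb gb by (simp add: x_def m_def n_def algebra_simps)
  have "adj x * x = m * (h * m)" by (simp add: x_def adj_mult am h_def mult.assoc)
  then have xx1: "adj x * x = - (m * H * m)" by (simp add: hm mult.assoc)
  have "x * adj x = n * (g * n)" by (simp add: xn adj_mult an g_def mult.assoc)
  then have xx2: "x * adj x = - (n * G * n)" by (simp add: gn mult.assoc)
  have p1: "psd (m * H * m)" and p2: "psd (n * G * n)"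
    using psd_commuting_conjugate(1) H(1) G(1) am an Hm Gn by blast+
  have "psd (- (m * H * m + n * G * n))"
    using adj_mult_self_plus_psd[of x] by (simp add: xx1 xx2)
  then have "m * H * m + n * G * n = 0" using psd_antisym[OF psd_add[OF p1 p2]] by simp
  then have "m * H * m = 0" using psd_add_eq_0[OF p1 p2] by simp
  then have "H * m = 0" using psd_commuting_conjugate(2)[OF H(1) am Hm] by simp
  \<comment> \<open>\<open>m * m = H * m - h * m\<close>, and both terms vanish.\<close>
  then have "m * m = 0" using hm by (metis m_def left_diff_distrib diff_0 minus_zero)
  then have "m = 0" using selfadjoint_square_eq_0[OF am] by simp
  then have "h = H" by (simp add: m_def)
  then show ?thesis using H(1) by (simp add: h_def)
qed

section \<open>Order and norm\<close>

lemma psd_conjugate: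
  fixes h :: "'a::{cstar_algebra,real_normed_algebra_1}"
  assumes "psd h"
  shows "psd (adj c * h * c)"
proof -
  obtain s where s: "adj s = s" "s * s = h" using assms by (auto simp: psd_def)
  then have "adj (s * c) * (s * c) = adj c * h * c" by (metis adj_mult mult.assoc)
  then show ?thesis using psd_adj_mult_self[of "s * c"] by simp
qed

text \<open>Roots \<open>r\<close> of \<open>u\<close> and \<open>s\<close> of \<open>t - u\<close>
  commute and their squares add up to \<open>t\<close>, so the sum-of-squares estimate applies to
  \<open>r\<close>.\<close>

lemma norm_psd_le:
  fixes u :: "'a::{cstar_algebra,real_normed_algebra_1}"
  assumes u: "psd u" and tu: "psd (t *\<^sub>R 1 - u)" and t: "0 \<le> t"
  shows "norm u \<le> t"
proof -
  obtain r where r: "psd r" "r * r = u" "\<And>b. u * b = b * u \<Longrightarrow> r * b = b * r"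
    using psd_sqrt_commute[OF u] by blast
  obtain s where s: "psd s" "s * s = t *\<^sub>R 1 - u"
    "\<And>b. (t *\<^sub>R 1 - u) * b = b * (t *\<^sub>R 1 - u) \<Longrightarrow> s * b = b * s"
    using psd_sqrt_commute[OF tu] by blast
  have "r * u = u * r" using r(2) by (metis mult.assoc)
  then have "s * r = r * s" by (intro s(3)) (simp add: algebra_simps)
  then have "(norm r)\<^sup>2 \<le> norm (r * r + s * s)"
    by (intro norm_square_le_sum_squares) (simp_all add: r(1) s(1) psd_selfadjoint)
  then show ?thesis
    using t norm_selfadjoint_square[OF psd_selfadjoint[OF r(1)]] by (simp add: r(2) s(2))
qed

text \<open>Chain \<open>u \<le> v \<le> norm v\<close> in the order given by
  \<open>psd\<close>.\<close>

lemma norm_psd_mono: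
  fixes u v :: "'a::{cstar_algebra,real_normed_algebra_1}"
  assumes "psd u" "psd (v - u)"
  shows "norm u \<le> norm v"
proof -
  have "psd v" using psd_add[OF assms] by simp
  then have "psd (norm v *\<^sub>R 1 - v)" by (intro psd_norm_minus) (auto dest: psd_selfadjoint)
  from psd_add[OF this assms(2)] show ?thesis
    by (intro norm_psd_le assms) (simp_all add: algebra_simps)
qed

text \<open>Bernoulli's inequality gives \<open>(1 + k t) (1 - t)\<^sup>k \<le> 1\<close> on \<open>[0, 1]\<close>.\<close>

lemma norm_mult_power_one_minus_le:
  fixes c :: "'a::{cstar_algebra,real_normed_algebra_1}"
  assumes c: "psd c" "norm c \<le> 1"
  shows "real k * norm (c * (1 - c) ^ k) \<le> 1"
proof -
  have sac: "adj c = c" by (rule psd_selfadjoint[OF c(1)])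
  obtain w where w: "psd w" "w * w = 1 - c" "\<And>b. (1 - c) * b = b * (1 - c) \<Longrightarrow> w * b = b * w"
    using psd_sqrt_commute[OF psd_norm_minus[OF sac c(2), unfolded scaleR_one]] by blast
  obtain s where s: "psd s" "s * s = c" "\<And>b. c * b = b * c \<Longrightarrow> s * b = b * s"
    using psd_sqrt_commute[OF c(1)] by blast
  have wc: "w * c = c * w" by (rule w(3)) (simp add: algebra_simps)
  have sw: "s * w = w * s" by (rule s(3)) (simp add: wc)
  have wk: "w ^ j * w ^ j = (1 - c) ^ j" for j
    using w(2) by (metis power_add mult_2 power_mult power2_eq_square)
  have awk: "adj (w ^ j) = w ^ j" for j
    by (induction j) (simp_all add: adj_mult psd_selfadjoint[OF w(1)] power_commutes)
  have cw: "y * w ^ j = w ^ j * y" if "y * w = w * y" for y j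
    using power_commuting_commutes[of w y j] that by simp
  \<comment> \<open>With \<open>w\<close> the root of \<open>1 - c\<close>, the element is the
    square of \<open>y * w ^ j\<close>.\<close>
  have psd_term: "psd (y * y * (1 - c) ^ j)" if "adj y = y" "y * w = w * y" for y j
  proof -
    have "adj (y * w ^ j) = y * w ^ j" using that cw by (simp add: adj_mult awk)
    then have "psd ((y * w ^ j) * (y * w ^ j))" by (rule psd_square)
    also have "(y * w ^ j) * (y * w ^ j) = y * y * (1 - c) ^ j"
      unfolding wk[symmetric] using cw[OF that(2), of j] by (metis mult.assoc)
    finally show ?thesis .
  qed
  \<comment> \<open>Passing from \<open>j\<close> to \<open>Suc j\<close> adds exactly
    \<open>Suc j\<close> times \<open>c * c * (1 - c) ^ j\<close>, which is positive.\<close>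
  have bern: "psd (1 - (1 + real j *\<^sub>R c) * (1 - c) ^ j)" for j
  proof (induction j)
    case (Suc j)
    have "psd (real (Suc j) *\<^sub>R (c * c * (1 - c) ^ j))"
      using sac wc by (intro psd_scaleR psd_term) auto
    then have "psd ((1 - (1 + real j *\<^sub>R c) * (1 - c) ^ j) + real (Suc j) *\<^sub>R (c * c * (1 - c) ^ j))"
      by (rule psd_add[OF Suc])
    also have "\<dots> = 1 - ((1 + real (Suc j) *\<^sub>R c) * (1 - c)) * (1 - c) ^ j"
      by (simp add: algebra_simps)
    finally show ?case by (simp add: mult.assoc)
  qed simp
  \<comment> \<open>Adding \<open>(1 - c) ^ k\<close> to the Bernoulli defect leaves 1 minus the
    element to be estimated.\<close>
  have "psd ((1 - (1 + real k *\<^sub>R c) * (1 - c) ^ k) + 1 * 1 * (1 - c) ^ k)"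
    by (intro psd_add bern psd_term) auto
  moreover have "psd (real k *\<^sub>R (c * (1 - c) ^ k))"
    using psd_term[of s k] sw s(1,2) by (intro psd_scaleR) (simp_all add: psd_selfadjoint)
  ultimately have "norm (real k *\<^sub>R (c * (1 - c) ^ k)) \<le> 1"
    by (intro norm_psd_le) (simp_all add: algebra_simps)
  then show ?thesis by simp
qed

section \<open>The unitization\<close>

text \<open>The pair stands for the formal sum of an algebra element and a scalar multiple of a new
  unit.\<close>

datatype 'a unitization = Unitization (alg_part: 'a) (scalar_part: complex)

lemma unitization_eq_iff: "X = Y \<longleftrightarrow> alg_part X = alg_part Y \<and> scalar_part X = scalar_part Y"
  by (auto intro: unitization.expand)

instantiation unitization :: (complex_vector) complex_vector
begin

definition "0 = Unitization 0 0"
definition "X + Y = Unitization (alg_part X + alg_part Y) (scalar_part X + scalar_part Y)"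
definition "- X = Unitization (- alg_part X) (- scalar_part X)"
definition "X - Y = Unitization (alg_part X - alg_part Y) (scalar_part X - scalar_part Y)"
definition "scaleR r X = Unitization (r *\<^sub>R alg_part X) (r *\<^sub>R scalar_part X)"
definition "scaleC c X = Unitization (scaleC c (alg_part X)) (c * scalar_part X)"

lemmas unitization_vector_defs = zero_unitization_def plus_unitization_def uminus_unitization_def
  minus_unitization_def scaleR_unitization_def scaleC_unitization_def

instance
  by intro_classes
    (simp_all add: unitization_vector_defs unitization_eq_iff algebra_simps scaleC_add_right
      scaleC_add_left scaleC_scaleC scaleC_one scaleR_scaleC of_real_def[symmetric] scaleR_conv_of_real)

end

lemma unitization_vector_simps [simp]:
  "alg_part 0 = 0" "scalar_part 0 = 0"
  "alg_part (X + Y) = alg_part X + alg_part Y" "scalar_part (X + Y) = scalar_part X + scalar_part Y"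
  "alg_part (- X) = - alg_part X" "scalar_part (- X) = - scalar_part X"
  "alg_part (X - Y) = alg_part X - alg_part Y" "scalar_part (X - Y) = scalar_part X - scalar_part Y"
  "alg_part (r *\<^sub>R X) = r *\<^sub>R alg_part X" "scalar_part (r *\<^sub>R X) = r *\<^sub>R scalar_part X"
  "alg_part (scaleC c X) = scaleC c (alg_part X)" "scalar_part (scaleC c X) = c * scalar_part X"
  by (simp_all add: unitization_vector_defs)

instantiation unitization :: (complex_normed_algebra) ring_1
begin

definition "1 = Unitization 0 1"
definition "X * Y = Unitization
  (alg_part X * alg_part Y + scaleC (scalar_part X) (alg_part Y) + scaleC (scalar_part Y) (alg_part X))
  (scalar_part X * scalar_part Y)"

instance
  by intro_classes
    (simp_all add: one_unitization_def times_unitization_def unitization_eq_iff algebra_simps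
      scaleC_add_right scaleC_add_left scaleC_scaleC scaleC_one scaleC_mult_left scaleC_mult_right)

end

lemma unitization_ring_simps [simp]:
  "alg_part 1 = 0" "scalar_part 1 = 1"
  "alg_part (X * Y) =
    alg_part X * alg_part Y + scaleC (scalar_part X) (alg_part Y) + scaleC (scalar_part Y) (alg_part X)"
  "scalar_part (X * Y) = scalar_part X * scalar_part Y"
  by (simp_all add: one_unitization_def times_unitization_def)

text \<open>Left multiplication on the original algebra, seen as an ideal of the
  unitization.\<close>

definition unit_act :: "'a::complex_normed_algebra unitization \<Rightarrow> 'a \<Rightarrow> 'a" where
  "unit_act X y = alg_part X * y + scaleC (scalar_part X) y"

lemma bounded_linear_unit_act: "bounded_linear (unit_act X)"
proof (rule bounded_linear_intro[where K = "norm (alg_part X) + cmod (scalar_part X)"])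
  show "unit_act X (y + z) = unit_act X y + unit_act X z" for y z
    by (simp add: unit_act_def scaleC_add_right algebra_simps)
  show "unit_act X (r *\<^sub>R y) = r *\<^sub>R unit_act X y" for r y
    by (simp add: unit_act_def scaleR_scaleC scaleC_mult_right scaleC_add_right scaleC_scaleC mult.commute)
  show "norm (unit_act X y) \<le> norm y * (norm (alg_part X) + cmod (scalar_part X))" for y
    unfolding unit_act_def
    using norm_triangle_ineq[of "alg_part X * y" "scaleC (scalar_part X) y"]
      norm_mult_ineq[of "alg_part X" y] by (simp add: norm_scaleC algebra_simps)
qed

lemma unit_act_mult: "unit_act (X * Y) y = unit_act X (unit_act Y y)"
  by (simp add: unit_act_def algebra_simps scaleC_add_right scaleC_scaleC scaleC_mult_left
      scaleC_mult_right)

lemma onorm_unit_act_mult_le: "onorm (unit_act (X * Y)) \<le> onorm (unit_act X) * onorm (unit_act Y)"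
proof -
  have "unit_act (X * Y) = unit_act X \<circ> unit_act Y" by (auto simp: unit_act_mult)
  then show ?thesis
    using onorm_compose[OF bounded_linear_unit_act bounded_linear_unit_act] by metis
qed

text \<open>The operator norm alone degenerates if the algebra already has a unit; taking the maximum with
  the C*-seminorm \<open>|\<lambda>|\<close> covers both cases.\<close>

instantiation unitization :: (cstar_algebra) real_normed_vector
begin

definition "norm X = max (cmod (scalar_part X)) (onorm (unit_act X))"
definition "sgn (X::'a unitization) = X /\<^sub>R norm X"
definition "dist X Y = norm (X - Y :: 'a unitization)"
definition "(uniformity :: ('a unitization \<times> 'a unitization) filter) =
  (INF e\<in>{0 <..}. principal {(X, Y). dist X Y < e})"
definition "open (U :: 'a unitization set) =
  (\<forall>X\<in>U. eventually (\<lambda>(X', Y). X' = X \<longrightarrow> Y \<in> U) uniformity)"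

instance
proof
  fix X Y :: "'a unitization" and r :: real
  show "norm X = 0 \<longleftrightarrow> X = 0"
  proof
    assume 0: "norm X = 0"
    then have l: "scalar_part X = 0" and "onorm (unit_act X) = 0"
      using onorm_pos_le[OF bounded_linear_unit_act[of X]]
      by (auto simp: norm_unitization_def max_def split: if_splits)
    \<comment> \<open>With zero scalar part, \<open>X\<close> acts as left multiplication; testing
      on the adjoint brings in the C*-identity.\<close>
    then have "unit_act X (adj (alg_part X)) = 0"
      using onorm_eq_0[OF bounded_linear_unit_act[of X]] by auto
    then have "adj (adj (alg_part X)) * adj (alg_part X) = 0"
      using l by (simp add: unit_act_def adj_adj)
    then have "adj (alg_part X) = 0" by (rule adj_mult_self_eq_0)
    then have "alg_part X = 0" by (metis adj_adj adj_zero)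
    with l show "X = 0" by (simp add: unitization_eq_iff)
  next
    assume "X = 0"
    then have "unit_act X = (\<lambda>y. 0)"
      by (intro ext) (simp add: unit_act_def)
    with \<open>X = 0\<close> show "norm X = 0" by (simp add: norm_unitization_def onorm_zero)
  qed
  have "unit_act (X + Y) = (\<lambda>y. unit_act X y + unit_act Y y)"
    by (auto simp: unit_act_def algebra_simps scaleC_add_left)
  then have "onorm (unit_act (X + Y)) \<le> onorm (unit_act X) + onorm (unit_act Y)"
    using onorm_triangle[OF bounded_linear_unit_act[of X] bounded_linear_unit_act[of Y]] by simp
  then show "norm (X + Y) \<le> norm X + norm Y"
    using norm_triangle_ineq[of "scalar_part X" "scalar_part Y"] by (auto simp: norm_unitization_def)
  have "unit_act (r *\<^sub>R X) = (\<lambda>y. r *\<^sub>R unit_act X y)"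
    by (auto simp: unit_act_def scaleR_scaleC scaleC_mult_left scaleC_add_right scaleC_scaleC
        scaleR_conv_of_real)
  then have "onorm (unit_act (r *\<^sub>R X)) = \<bar>r\<bar> * onorm (unit_act X)"
    using onorm_scaleR[OF bounded_linear_unit_act[of X]] by simp
  then show "norm (r *\<^sub>R X) = \<bar>r\<bar> * norm X"
    by (simp add: norm_unitization_def max_mult_distrib_left)
qed (simp_all add: sgn_unitization_def dist_unitization_def uniformity_unitization_def
    open_unitization_def)

end

lemma cmod_scalar_part_le: "cmod (scalar_part X) \<le> norm (X::'a::cstar_algebra unitization)"
  by (simp add: norm_unitization_def)

instance unitization :: (cstar_algebra) real_normed_algebra_1
proof
  fix X Y :: "'a unitization" and r :: real
  show "r *\<^sub>R X * Y = r *\<^sub>R (X * Y)" "X * r *\<^sub>R Y = r *\<^sub>R (X * Y)"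
    by (simp_all add: unitization_eq_iff scaleR_scaleC scaleC_mult_left scaleC_mult_right
        scaleC_add_right scaleC_scaleC scaleR_conv_of_real mult.commute)
  show "norm (X * Y) \<le> norm X * norm Y"
  proof -
    have "cmod (scalar_part X) * cmod (scalar_part Y) \<le> norm X * norm Y"
      by (intro mult_mono cmod_scalar_part_le) auto
    moreover have "onorm (unit_act X) * onorm (unit_act Y) \<le> norm X * norm Y"
      by (intro mult_mono)
        (auto simp: norm_unitization_def le_max_iff_disj onorm_pos_le[OF bounded_linear_unit_act])
    ultimately show ?thesis
      using onorm_unit_act_mult_le[of X Y] by (simp add: norm_unitization_def[of "X * Y"] norm_mult)
  qed
  have "unit_act (1::'a unitization) = (\<lambda>y. y)" by (auto simp: unit_act_def scaleC_one)
  then show "norm (1::'a unitization) = 1"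
    using onorm_id_le[where 'a='a] by (simp add: norm_unitization_def)
qed

abbreviation uembed :: "'a::cstar_algebra \<Rightarrow> 'a unitization" where
  "uembed x \<equiv> Unitization x 0"

text \<open>Left multiplication by \<open>x\<close> attains its bound \<open>norm x\<close> at
  \<open>adj x\<close>, by the C*-identity.\<close>

lemma norm_uembed [simp]: "norm (uembed x) = norm (x::'a::cstar_algebra)"
proof -
  have act: "unit_act (uembed x) = (\<lambda>y. x * y)" by (auto simp: unit_act_def)
  have "onorm (unit_act (uembed x)) \<le> norm x"
    unfolding act by (rule onorm_bound) (auto simp: norm_mult_ineq)
  moreover have "norm x \<le> onorm (unit_act (uembed x))"
  proof (cases "x = 0")
    case False
    have "norm (x * adj x) \<le> onorm (unit_act (uembed x)) * norm (adj x)"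
      using onorm[OF bounded_linear_unit_act, of "uembed x" "adj x"] by (simp add: act)
    moreover have "norm (x * adj x) = norm x * norm x"
      using cstar_identity[of "adj x"] by (simp add: adj_adj power2_eq_square)
    ultimately show ?thesis using False by simp
  qed (simp add: onorm_pos_le[OF bounded_linear_unit_act])
  ultimately have "onorm (unit_act (uembed x)) = norm x" by simp
  then show ?thesis by (simp add: norm_unitization_def)
qed

instance unitization :: (cstar_algebra) complex_normed_algebra
proof
  fix X Y :: "'a unitization" and c :: complex
  have "onorm (unit_act (scaleC c X)) = cmod c * onorm (unit_act X)"
  proof -
    have act: "unit_act (scaleC c X) y = scaleC c (unit_act X y)"
      for c :: complex and X :: "'a unitization" and y
      by (simp add: unit_act_def scaleC_mult_left scaleC_add_right scaleC_scaleC)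
    have le: "onorm (unit_act (scaleC c X)) \<le> cmod c * onorm (unit_act X)"
      for c :: complex and X :: "'a unitization"
      by (rule onorm_bound)
        (auto simp: act norm_scaleC mult.assoc onorm_pos_le[OF bounded_linear_unit_act]
          intro!: mult_left_mono onorm[OF bounded_linear_unit_act])
    show ?thesis
    proof (cases "c = 0")
      case False
      have "onorm (unit_act X) \<le> cmod (inverse c) * onorm (unit_act (scaleC c X))"
        using le[of "inverse c" "scaleC c X"] False by (simp add: scaleC_scaleC scaleC_one)
      then show ?thesis using le[of c X] False by (simp add: norm_divide field_simps)
    qed (use le[of 0 X] onorm_pos_le[OF bounded_linear_unit_act[of "scaleC 0 X"]] in simp)
  qed
  then show "norm (scaleC c X) = cmod c * norm X"
    by (simp add: norm_unitization_def norm_mult max_mult_distrib_left)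
  show "scaleC c X * Y = scaleC c (X * Y)" "X * scaleC c Y = scaleC c (X * Y)"
    by (simp_all add: unitization_eq_iff scaleC_mult_left scaleC_mult_right
        scaleC_add_right scaleC_scaleC mult.commute)
qed

text \<open>Both coordinates are bounded linear maps, and the norm is at most the sum of the
  coordinate norms, so completeness holds coordinatewise.\<close>

instance unitization :: (cstar_algebra) banach
proof
  fix X :: "nat \<Rightarrow> 'a unitization"
  assume X: "Cauchy X"
  have alg_le: "norm (alg_part Y) \<le> 2 * norm Y" for Y :: "'a unitization"
  proof -
    have "uembed (alg_part Y) = Y - scaleC (scalar_part Y) 1" by (simp add: unitization_eq_iff)
    then have "norm (uembed (alg_part Y)) \<le> norm Y + norm (scaleC (scalar_part Y) (1::'a unitization))"
      by (metis norm_triangle_ineq4)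
    then show ?thesis using cmod_scalar_part_le[of Y] by (simp add: norm_scaleC)
  qed
  have "bounded_linear (alg_part :: 'a unitization \<Rightarrow> 'a)"
    by (rule bounded_linear_intro[of _ 2]) (use alg_le in \<open>auto simp: mult.commute\<close>)
  then have "Cauchy (\<lambda>n. alg_part (X n))" using X by (rule bounded_linear.Cauchy)
  then obtain x where x: "(\<lambda>n. alg_part (X n)) \<longlonglongrightarrow> x"
    using Cauchy_convergent convergent_def by blast
  have "bounded_linear (scalar_part :: 'a unitization \<Rightarrow> complex)"
    by (rule bounded_linear_intro[of _ 1]) (use cmod_scalar_part_le in auto)
  then have "Cauchy (\<lambda>n. scalar_part (X n))" using X by (rule bounded_linear.Cauchy)
  then obtain c where c: "(\<lambda>n. scalar_part (X n)) \<longlonglongrightarrow> c"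
    using Cauchy_convergent convergent_def by blast
  have le: "norm (X n - Unitization x c) \<le> norm (alg_part (X n) - x) + cmod (scalar_part (X n) - c)" for n
  proof -
    have "X n - Unitization x c = uembed (alg_part (X n) - x) + scaleC (scalar_part (X n) - c) 1"
      by (simp add: unitization_eq_iff)
    then show ?thesis
      by (metis norm_triangle_ineq norm_uembed norm_scaleC norm_one mult.right_neutral)
  qed
  have "(\<lambda>n. norm (alg_part (X n) - x) + cmod (scalar_part (X n) - c)) \<longlonglongrightarrow> 0 + 0"
    by (intro tendsto_add tendsto_norm_zero LIM_zero x c)
  then have "(\<lambda>n. norm (X n - Unitization x c)) \<longlonglongrightarrow> 0"
    by (intro Lim_null_comparison[of "\<lambda>n. norm (X n - Unitization x c)"]) (use le in auto)
  then have "X \<longlonglongrightarrow> Unitization x c" by (simp add: tendsto_norm_zero_iff LIM_zero_iff)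
  then show "convergent X" by (auto simp: convergent_def)
qed

instantiation unitization :: (cstar_algebra) cstar_algebra
begin

definition "adj X = Unitization (adj (alg_part X)) (cnj (scalar_part X))"

instance
proof
  fix X Y :: "'a unitization" and c :: complex
  show adj_adj': "adj (adj X) = X" for X :: "'a unitization"
    by (simp add: adj_unitization_def adj_adj)
  show "adj (X + Y) = adj X + adj Y" "adj (X * Y) = adj Y * adj X"
    "adj (scaleC c X) = scaleC (cnj c) (adj X)"
    by (simp_all add: adj_unitization_def unitization_eq_iff adj_add adj_mult adj_scaleC)
  \<comment> \<open>The C*-identity in the original algebra rewrites the squared norm of
    \<open>unit_act X y\<close> as that of \<open>adj y * unit_act (adj X * X) y\<close>.\<close>
  have sq: "(onorm (unit_act X))\<^sup>2 \<le> onorm (unit_act (adj X * X))" for X :: "'a unitization"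
  proof -
    let ?K = "onorm (unit_act (adj X * X))"
    have K: "0 \<le> ?K" by (rule onorm_pos_le[OF bounded_linear_unit_act])
    have "norm (unit_act X y) \<le> sqrt ?K * norm y" for y
    proof -
      have "adj (unit_act X y) * unit_act X y = adj y * unit_act (adj X * X) y"
        by (simp add: unit_act_mult)
          (simp add: unit_act_def adj_unitization_def adj_add adj_mult adj_scaleC algebra_simps
            scaleC_mult_left scaleC_mult_right scaleC_add_right scaleC_scaleC)
      then have "(norm (unit_act X y))\<^sup>2 = norm (adj y * unit_act (adj X * X) y)"
        by (metis cstar_identity)
      also have "\<dots> \<le> norm y * (?K * norm y)"
        using onorm[OF bounded_linear_unit_act, of "adj X * X" y]
        by (intro order_trans[OF norm_mult_ineq] mult_mono) auto
      also have "\<dots> = (sqrt ?K * norm y)\<^sup>2" using K by (simp add: power_mult_distrib power2_eq_square)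
      finally show ?thesis by (rule power2_le_imp_le) (use K in simp)
    qed
    then have "onorm (unit_act X) \<le> sqrt ?K" using K by (intro onorm_bound) auto
    then have "(onorm (unit_act X))\<^sup>2 \<le> (sqrt ?K)\<^sup>2"
      by (rule power_mono) (rule onorm_pos_le[OF bounded_linear_unit_act])
    then show ?thesis using K by simp
  qed
  \<comment> \<open>Combine \<open>sq\<close> with submultiplicativity and cancel one
    factor.\<close>
  have le: "onorm (unit_act X) \<le> onorm (unit_act (adj X))" for X :: "'a unitization"
  proof (cases "onorm (unit_act X) = 0")
    case False
    then show ?thesis
      using order_trans[OF sq onorm_unit_act_mult_le, of X] onorm_pos_le[OF bounded_linear_unit_act[of X]]
      by (simp add: power2_eq_square)
  qed (simp add: onorm_pos_le[OF bounded_linear_unit_act])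
  have "onorm (unit_act (adj X)) = onorm (unit_act X)"
    using le[of X] le[of "adj X"] by (simp add: adj_adj')
  then have eq: "onorm (unit_act (adj X * X)) = (onorm (unit_act X))\<^sup>2"
    using sq[of X] onorm_unit_act_mult_le[of "adj X" X] by (simp add: power2_eq_square)
  have s: "cmod (scalar_part (adj X * X)) = (cmod (scalar_part X))\<^sup>2"
    by (simp add: adj_unitization_def norm_mult power2_eq_square)
  have "0 \<le> onorm (unit_act X)" by (rule onorm_pos_le[OF bounded_linear_unit_act])
  then show "norm (adj X * X) = (norm X)\<^sup>2"
    unfolding norm_unitization_def eq s by (auto simp: max_def power_mono_iff)
qed

end

lemma adj_uembed: "adj (uembed x) = uembed (adj x)"
  by (simp add: adj_unitization_def)

lemma mult_uembed: "uembed x * uembed y = uembed (x * y)"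
  by (simp add: unitization_eq_iff)

section \<open>A Hahn--Banach theorem\<close>

definition sublinear :: "('a::real_vector \<Rightarrow> real) \<Rightarrow> bool" where
  "sublinear p \<longleftrightarrow> (\<forall>x y. p (x + y) \<le> p x + p y) \<and> (\<forall>t x. 0 < t \<longrightarrow> p (t *\<^sub>R x) = t * p x)"

lemma sublinear_add: "sublinear p \<Longrightarrow> p (x + y) \<le> p x + p y"
  by (simp add: sublinear_def)

lemma sublinear_scaleR: "sublinear p \<Longrightarrow> 0 < t \<Longrightarrow> p (t *\<^sub>R x) = t * p x"
  by (simp add: sublinear_def)

lemma sublinear_zero: "sublinear p \<Longrightarrow> p 0 = 0"
  using sublinear_scaleR[of p 2 0] by simp

lemma sublinear_minus: "sublinear p \<Longrightarrow> - p (- x) \<le> p x"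
  using sublinear_add[of p x "- x"] sublinear_zero[of p] by simp

text \<open>Inequalities suffice as hypotheses: the scaling inequality for \<open>inverse t\<close>
  reverses the one for \<open>t\<close>.\<close>

lemma sublinear_Inf:
  fixes E :: "'a::real_vector \<Rightarrow> real set"
  assumes ne: "\<And>x. E x \<noteq> {}" and bdd: "\<And>x. bdd_below (E x)"
    and add: "\<And>x y a b. a \<in> E x \<Longrightarrow> b \<in> E y \<Longrightarrow> \<exists>e\<in>E (x + y). e \<le> a + b"
    and scale: "\<And>t x a. 0 < t \<Longrightarrow> a \<in> E x \<Longrightarrow> \<exists>e\<in>E (t *\<^sub>R x). e \<le> t * a"
  shows "sublinear (\<lambda>x. Inf (E x))"
proof -
  let ?g = "\<lambda>x. Inf (E x)"
  have lower: "?g x \<le> c" if "\<exists>e\<in>E x. e \<le> c" for x c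
    using that bdd cInf_lower order_trans by meson
  have scale_le: "?g (t *\<^sub>R x) \<le> t * ?g x" if t: "0 < t" for t x
  proof -
    have "?g (t *\<^sub>R x) / t \<le> a" if a: "a \<in> E x" for a
      using lower[OF scale[OF t a]] t by (simp add: divide_le_eq mult.commute)
    then have "?g (t *\<^sub>R x) / t \<le> ?g x" using ne by (intro cInf_greatest)
    then show ?thesis using t by (simp add: divide_le_eq mult.commute)
  qed
  have "?g (t *\<^sub>R x) = t * ?g x" if t: "0 < t" for t x
  proof -
    have "?g (inverse t *\<^sub>R (t *\<^sub>R x)) \<le> inverse t * ?g (t *\<^sub>R x)" using t by (intro scale_le) simp
    then have "?g x \<le> ?g (t *\<^sub>R x) / t" using t by (simp add: divide_inverse mult.commute)
    then have "t * ?g x \<le> ?g (t *\<^sub>R x)" using t by (simp add: le_divide_eq mult.commute)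
    then show ?thesis using scale_le[OF t, of x] by simp
  qed
  moreover have "?g (x + y) \<le> ?g x + ?g y" for x y
  proof -
    have "?g (x + y) - a \<le> b" if ab: "a \<in> E x" "b \<in> E y" for a b
      using lower[OF add[OF ab]] by simp
    then have "?g (x + y) - a \<le> ?g y" if "a \<in> E x" for a
      using ne that by (intro cInf_greatest) auto
    then have "?g (x + y) - ?g y \<le> a" if "a \<in> E x" for a
      using that by (simp add: algebra_simps)
    then have "?g (x + y) - ?g y \<le> ?g x" using ne by (intro cInf_greatest) auto
    then show ?thesis by simp
  qed
  ultimately show ?thesis unfolding sublinear_def by blast
qed

lemma sublinear_INF:
  fixes f :: "'i \<Rightarrow> 'a::real_vector \<Rightarrow> real"
  assumes "I \<noteq> {}" "\<And>x. bdd_below ((\<lambda>i. f i x) ` I)"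
    and "\<And>x y i j. i \<in> I \<Longrightarrow> j \<in> I \<Longrightarrow> \<exists>k\<in>I. f k (x + y) \<le> f i x + f j y"
    and "\<And>t x i. 0 < t \<Longrightarrow> i \<in> I \<Longrightarrow> \<exists>k\<in>I. f k (t *\<^sub>R x) \<le> t * f i x"
  shows "sublinear (\<lambda>x. INF i\<in>I. f i x)"
  using assms by (intro sublinear_Inf) auto

text \<open>Pushing a sublinear \<open>p\<close> down along the ray spanned by \<open>y\<close>, so that it becomes additive there.\<close>

lemma sublinear_directional:
  assumes p: "sublinear p"
  obtains p' where "sublinear p'" "\<And>x. p' x \<le> p x" "\<And>x. p' x \<le> p (x + y) - p y"
proof -
  let ?f = "\<lambda>t x. p (x + t *\<^sub>R y) - t * p y" and ?I = "{0::real..}"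
  let ?g = "\<lambda>x. INF t\<in>?I. ?f t x"
  have ty: "p (t *\<^sub>R y) = t * p y" if "0 \<le> t" for t
    using that sublinear_scaleR[OF p, of t y] sublinear_zero[OF p] by (cases "t = 0") auto
  have "- p (- x) \<le> ?f t x" if "0 \<le> t" for t x
    using sublinear_add[OF p, of "x + t *\<^sub>R y" "- x"] ty[OF that] by simp
  then have bdd: "bdd_below ((\<lambda>t. ?f t x) ` ?I)" for x by (intro bdd_belowI2[of _ "- p (- x)"]) auto
  have "sublinear ?g"
  proof (rule sublinear_INF)
    fix x z s t assume st: "s \<in> ?I" "t \<in> ?I"
    have "?f (s + t) (x + z) \<le> ?f s x + ?f t z"
      using sublinear_add[OF p, of "x + s *\<^sub>R y" "z + t *\<^sub>R y"] by (simp add: algebra_simps)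
    then show "\<exists>k\<in>?I. ?f k (x + z) \<le> ?f s x + ?f t z" using st by (intro bexI[of _ "s + t"]) auto
  next
    fix t x s assume t: "0 < (t::real)" and s: "s \<in> ?I"
    have "?f (t * s) (t *\<^sub>R x) \<le> t * ?f s x"
      using sublinear_scaleR[OF p t, of "x + s *\<^sub>R y"] by (simp add: algebra_simps)
    then show "\<exists>k\<in>?I. ?f k (t *\<^sub>R x) \<le> t * ?f s x" using t s by (intro bexI[of _ "t * s"]) auto
  qed (use bdd in auto)
  \<comment> \<open>The parameter 0 gives the bound by \<open>p\<close>, the parameter 1 the drop
    along \<open>y\<close>.\<close>
  moreover have "?g x \<le> p x" for x
    using cINF_lower[OF bdd, of 0 x] by simp
  moreover have "?g x \<le> p (x + y) - p y" for x
    using cINF_lower[OF bdd, of 1 x] by simp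
  ultimately show thesis using that by blast
qed

text \<open>A minimal sublinear functional is additive, since pushing it down along any direction
  cannot lower it.\<close>

theorem Hahn_Banach_sublinear:
  fixes p :: "'a::real_vector \<Rightarrow> real"
  assumes p: "sublinear p"
  obtains \<phi> where "linear \<phi>" "\<And>x. \<phi> x \<le> p x" "\<phi> x0 = p x0"
proof -
  \<comment> \<open>At \<open>- x0\<close> the last bound reads
    \<open>p0 (- x0) \<le> - p x0\<close>, which later forces equality at \<open>x0\<close>.\<close>
  obtain p0 where p0: "sublinear p0" "\<And>x. p0 x \<le> p x" "\<And>x. p0 x \<le> p (x + x0) - p x0"
    using sublinear_directional[OF p] by blast
  define S where "S = {q. sublinear q \<and> (\<forall>x. q x \<le> p0 x)}"
  \<comment> \<open>The pointwise order is reversed, so that Zorn's lemma delivers a minimal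
    element.\<close>
  define R where "R = {(q, q'). q \<in> S \<and> q' \<in> S \<and> (\<forall>x. q' x \<le> q x)}"
  have field: "Field R = S" by (auto simp: R_def Field_def)
  have po: "Partial_order R"
    unfolding order_on_defs field
    by (auto simp: R_def refl_on_def trans_def antisym_def fun_eq_iff intro: order_trans antisym)
  have "\<exists>u\<in>Field R. \<forall>q\<in>C. (q, u) \<in> R" if C: "C \<in> Chains R" for C
  proof (cases "C = {}")
    case True
    have "p0 \<in> S" using p0 by (simp add: S_def)
    with True show ?thesis unfolding field by blast
  next
    case False
    have CS: "q \<in> S" if "q \<in> C" for q using C that by (auto simp: Chains_def R_def)
    have chain: "(\<forall>x. q x \<le> q' x) \<or> (\<forall>x. q' x \<le> q x)" if "q \<in> C" "q' \<in> C" for q q'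
      using C that by (auto simp: Chains_def R_def)
    have bdd: "bdd_below ((\<lambda>q. q x) ` C)" for x
    proof (intro bdd_belowI2[of _ "- p0 (- x)"])
      fix q assume "q \<in> C"
      then have "q \<in> S" by (rule CS)
      then have "q (- x) \<le> p0 (- x)" "- q (- x) \<le> q x" by (auto simp: S_def intro: sublinear_minus)
      then show "- p0 (- x) \<le> q x" by linarith
    qed
    let ?u = "\<lambda>x. INF q\<in>C. q x"
    have low: "?u x \<le> q x" if "q \<in> C" for q x using cINF_lower[OF bdd that] .
    have "sublinear ?u"
    proof (rule sublinear_INF[OF False bdd])
      fix x y q q' assume q: "q \<in> C" "q' \<in> C"
      from chain[OF q] show "\<exists>k\<in>C. k (x + y) \<le> q x + q' y"
      proof
        assume "\<forall>x. q x \<le> q' x"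
        then have "q y \<le> q' y" by blast
        moreover have "q (x + y) \<le> q x + q y" using CS[OF q(1)] by (simp add: S_def sublinear_add)
        ultimately show ?thesis using q(1) by (intro bexI[of _ q]) auto
      next
        assume "\<forall>x. q' x \<le> q x"
        then have "q' x \<le> q x" by blast
        moreover have "q' (x + y) \<le> q' x + q' y" using CS[OF q(2)] by (simp add: S_def sublinear_add)
        ultimately show ?thesis using q(2) by (intro bexI[of _ q']) auto
      qed
    next
      fix t x q assume "0 < (t::real)" "q \<in> C"
      then show "\<exists>k\<in>C. k (t *\<^sub>R x) \<le> t * q x"
        using CS[of q] by (intro bexI[of _ q]) (auto simp: S_def sublinear_scaleR)
    qed
    moreover have "?u x \<le> p0 x" for x
    proof -
      obtain q where q: "q \<in> C" using False by blast
      then have "q x \<le> p0 x" using CS by (simp add: S_def)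
      then show ?thesis using low[OF q] order_trans by blast
    qed
    ultimately have "?u \<in> S" by (simp add: S_def)
    then show ?thesis unfolding field using low CS by (intro bexI[of _ ?u]) (auto simp: R_def)
  qed
  from Zorns_po_lemma[OF po this] obtain m where m: "m \<in> S"
    and min: "\<And>q. q \<in> S \<Longrightarrow> (\<forall>x. q x \<le> m x) \<Longrightarrow> q = m"
    unfolding field by (auto simp: R_def)
  have sm: "sublinear m" and mp0: "\<And>x. m x \<le> p0 x" using m by (auto simp: S_def)
  have add: "m (x + y) = m x + m y" for x y
  proof -
    obtain q where q: "sublinear q" "\<And>x. q x \<le> m x" "\<And>x. q x \<le> m (x + y) - m y"
      using sublinear_directional[OF sm] by blast
    then have "q \<in> S" using mp0 by (auto simp: S_def intro: order_trans)
    then have "q = m" using min q(2) by blast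
    then show ?thesis using q(3)[of x] sublinear_add[OF sm, of x y] by simp
  qed
  have neg: "m (- x) = - m x" for x
    using add[of x "- x"] sublinear_zero[OF sm] by simp
  have "m (t *\<^sub>R x) = t *\<^sub>R m x" for t x
  proof (cases t "0::real" rule: linorder_cases)
    case less
    then have "m ((- t) *\<^sub>R x) = - t * m x" by (intro sublinear_scaleR[OF sm]) simp
    then show ?thesis using neg[of "t *\<^sub>R x"] by simp
  qed (use sublinear_scaleR[OF sm] sublinear_zero[OF sm] in auto)
  then have "linear m" using add by (intro linearI)
  moreover have mp: "m x \<le> p x" for x using mp0 p0(2) order_trans by blast
  moreover have "m x0 = p x0"
    using mp0[of "- x0"] p0(3)[of "- x0"] neg[of x0] mp[of x0] sublinear_zero[OF p] by simp
  ultimately show thesis using that by blast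
qed

section \<open>Positive elements and their square roots\<close>

text \<open>The scalar part of a root squares to 0, so roots of embedded elements are themselves
  embedded.\<close>

lemma psd_uembed_iff: "psd (uembed x) \<longleftrightarrow> psd x"
proof
  assume "psd (uembed x)"
  then obtain S where S: "adj S = S" "S * S = uembed x" by (auto simp: psd_def)
  have "scalar_part (S * S) = 0" by (simp only: S(2) unitization.sel)
  then have "S = uembed (alg_part S)" by (simp add: unitization_eq_iff)
  then have "adj (alg_part S) = alg_part S" "alg_part S * alg_part S = x"
    using S by (metis adj_uembed mult_uembed unitization.sel(1))+
  then show "psd x" unfolding psd_def by blast
next
  assume "psd x"
  then show "psd (uembed x)" unfolding psd_def by (metis adj_uembed mult_uembed)
qed

lemma positive_iff_psd: "positive x \<longleftrightarrow> psd x"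
proof
  assume "positive x"
  then obtain b where "x = adj b * b" by (auto simp: positive_def)
  then have "uembed x = adj (uembed b) * uembed b" by (simp add: adj_uembed mult_uembed)
  then show "psd x" using psd_adj_mult_self by (metis psd_uembed_iff)
qed (metis positive_def psd_def)

text \<open>Existence and uniqueness are pulled back from the unitization, which makes the definite
  description in \<open>pos_sqrt\<close> meaningful.\<close>

lemma pos_sqrt:
  assumes "positive a"
  shows "psd (pos_sqrt a)" "pos_sqrt a * pos_sqrt a = a"
proof -
  have "psd (uembed a)" using assms by (simp add: psd_uembed_iff positive_iff_psd)
  then obtain R where R: "psd R" "R * R = uembed a" by (rule psd_sqrt_commute)
  have "scalar_part (R * R) = 0" by (simp only: R(2) unitization.sel)
  then have e: "R = uembed (alg_part R)" by (simp add: unitization_eq_iff)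
  define r where "r = alg_part R"
  have r: "psd r" "r * r = a"
    using R e unfolding r_def by (metis psd_uembed_iff, metis mult_uembed unitization.sel(1))
  have "pos_sqrt a = r" unfolding pos_sqrt_def positive_iff_psd
  proof (rule the_equality)
    fix s assume "psd s \<and> s * s = a"
    then have "psd s" "s * s = a" by auto
    with r have "psd (uembed s)" "psd (uembed r)" "uembed s * uembed s = uembed r * uembed r"
      by (simp_all add: psd_uembed_iff mult_uembed)
    then have "uembed s = uembed r" by (rule psd_sqrt_unique)
    then show "s = r" by simp
  qed (use r in simp)
  then show "psd (pos_sqrt a)" "pos_sqrt a * pos_sqrt a = a" using r by simp_all
qed

section \<open>Functionals\<close>

lemma cdual_zero: "f \<in> cdual \<Longrightarrow> f 0 = 0"
  unfolding cdual_def clinear_functional_def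
  by (metis (mono_tags, lifting) mem_Collect_eq scaleC_zero_left mult_zero_left)

lemma cdual_bounded:
  assumes f: "f \<in> cdual"
  obtains K where "\<And>x. norm x \<le> 1 \<Longrightarrow> cmod (f x) \<le> K"
proof -
  have "continuous_on UNIV f" and sc: "\<And>c x. f (scaleC c x) = c * f x"
    using f by (auto simp: cdual_def clinear_functional_def)
  then have "isCont f 0" by (simp add: continuous_on_eq_continuous_at)
  then obtain d where d: "d > 0" "\<And>x. norm x < d \<Longrightarrow> cmod (f x) < 1"
    using cdual_zero[OF f] unfolding continuous_at_eps_delta by (metis diff_zero dist_norm zero_less_one)
  \<comment> \<open>Scaling \<open>x\<close> by \<open>d/2\<close> brings it into the ball of radius
    \<open>d\<close>, where \<open>f\<close> is below 1.\<close>
  have "cmod (f x) \<le> 2 / d" if "norm x \<le> 1" for x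
  proof -
    have "norm (scaleC (complex_of_real (d/2)) x) < d"
      using that d(1) mult_left_mono[OF that, of "d/2"] by (simp add: norm_scaleC)
    from d(2)[OF this] show ?thesis using d(1) by (simp add: sc norm_mult field_simps)
  qed
  then show thesis using that by blast
qed

section \<open>The dual norm and the reduction to definiteness\<close>

lemma cmod_le_dual_norm:
  assumes "f \<in> cdual" "norm x \<le> 1"
  shows "cmod (f x) \<le> dual_norm f"
proof -
  obtain K where "\<And>x. norm x \<le> 1 \<Longrightarrow> cmod (f x) \<le> K" using cdual_bounded[OF assms(1)] by blast
  then show ?thesis unfolding dual_norm_def
    using assms(2) by (intro cSup_upper) (auto simp: bdd_above_def)
qed

lemma dual_norm_least:
  fixes f :: "'a::complex_normed_vector \<Rightarrow> complex"
  assumes "\<And>x. norm x \<le> 1 \<Longrightarrow> cmod (f x) \<le> c"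
  shows "dual_norm f \<le> c"
  unfolding dual_norm_def using assms by (intro cSup_least) (auto intro!: exI[of _ "0::'a"])

lemma cdual_scale: "f \<in> cdual \<Longrightarrow> (\<lambda>x. c * f x) \<in> cdual"
  by (auto simp: cdual_def clinear_functional_def algebra_simps intro!: continuous_intros)

lemma cdual_conjugate:
  fixes r :: "'a::complex_normed_algebra"
  assumes "f \<in> cdual"
  shows "(\<lambda>x. f (r * x * r)) \<in> cdual"
proof -
  have "continuous_on UNIV (f \<circ> (\<lambda>x. r * x * r))"
    using assms by (intro continuous_on_compose continuous_intros)
      (auto simp: cdual_def intro: continuous_on_subset)
  then show ?thesis using assms
    by (auto simp: cdual_def clinear_functional_def o_def algebra_simps scaleC_mult_left scaleC_mult_right)
qed

lemma dual_norm_nonneg: "f \<in> cdual \<Longrightarrow> 0 \<le> dual_norm f"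
  using cmod_le_dual_norm[of f 0] cdual_zero[of f] by simp

lemma dual_norm_triangle:
  "f \<in> cdual \<Longrightarrow> g \<in> cdual \<Longrightarrow> dual_norm (\<lambda>x. f x + g x) \<le> dual_norm f + dual_norm g"
  by (intro dual_norm_least order_trans[OF norm_triangle_ineq] add_mono cmod_le_dual_norm)

lemma dual_norm_scale:
  assumes f: "f \<in> cdual"
  shows "dual_norm (\<lambda>x. c * f x) = cmod c * dual_norm f"
proof (rule antisym)
  show "dual_norm (\<lambda>x. c * f x) \<le> cmod c * dual_norm f"
    by (intro dual_norm_least) (simp add: norm_mult mult_left_mono cmod_le_dual_norm[OF f])
  show "cmod c * dual_norm f \<le> dual_norm (\<lambda>x. c * f x)"
  proof (cases "c = 0")
    case False
    have "dual_norm f \<le> dual_norm (\<lambda>x. c * f x) / cmod c"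
      using False cmod_le_dual_norm[OF cdual_scale[OF f]]
      by (intro dual_norm_least) (simp add: norm_mult field_simps)
    then show ?thesis using False by (simp add: field_simps)
  qed (use dual_norm_nonneg[OF cdual_scale[OF f, of 0]] in simp)
qed

lemma dual_norm_eq_0_iff:
  assumes f: "f \<in> cdual"
  shows "dual_norm f = 0 \<longleftrightarrow> f = (\<lambda>x. 0)"
proof
  assume z: "dual_norm f = 0"
  have sc: "\<And>c x. f (scaleC c x) = c * f x" using f by (auto simp: cdual_def clinear_functional_def)
  have "f x = 0" for x
  proof (cases "x = 0")
    case False
    have "cmod (f (scaleC (complex_of_real (1 / norm x)) x)) \<le> 0"
      unfolding z[symmetric] using False
      by (intro cmod_le_dual_norm[OF f]) (simp add: norm_scaleC norm_divide)
    then show ?thesis using False by (simp add: sc)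
  qed (use cdual_zero[OF f] in simp)
  then show "f = (\<lambda>x. 0)" by blast
next
  assume "f = (\<lambda>x. 0)"
  then show "dual_norm f = 0"
    using dual_norm_least[of f 0] dual_norm_nonneg[OF f] by simp
qed

text \<open>The other norm axioms are inherited from \<open>dual_norm\<close>; only definiteness is
  at stake.\<close>

lemma is_norm_on_conjugate_iff:
  fixes r :: "'a::complex_normed_algebra"
  shows "is_norm_on cdual (\<lambda>f. dual_norm (\<lambda>x. f (r * x * r))) \<longleftrightarrow>
    (\<forall>f\<in>cdual. (\<forall>x. f (r * x * r) = 0) \<longrightarrow> f = (\<lambda>x. 0))"
proof -
  have "dual_norm (\<lambda>x. f (r * x * r)) = 0 \<longleftrightarrow> (\<forall>x. f (r * x * r) = 0)" if "f \<in> cdual" for f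
    using dual_norm_eq_0_iff[OF cdual_conjugate[OF that, of r]] by (simp add: fun_eq_iff)
  then show ?thesis
    unfolding is_norm_on_def
    by (simp add: dual_norm_nonneg dual_norm_triangle dual_norm_scale cdual_conjugate)
qed

text \<open>Degenerate Cauchy--Schwarz: on \<open>adj (z + scaleC c y) * (z + scaleC c y)\<close>
  the term quadratic in \<open>c\<close> drops out, and a nonnegative affine function on the real
  line is constant.\<close>

lemma positive_functional_vanish:
  assumes \<phi>: "positive_functional \<phi>" and 0: "\<phi> (adj y * y) = 0"
  shows "\<phi> (adj y * z) = 0"
proof -
  have add: "\<And>x y. \<phi> (x + y) = \<phi> x + \<phi> y" and sc: "\<And>c x. \<phi> (scaleC c x) = c * \<phi> x"
    using \<phi> by (auto simp: positive_functional_def cdual_def clinear_functional_def)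
  have pos: "Im (\<phi> (adj w * w)) = 0 \<and> 0 \<le> Re (\<phi> (adj w * w))" for w
    using \<phi> unfolding positive_functional_def positive_def by blast
  define \<alpha> \<beta> where "\<alpha> = \<phi> (adj y * z)" and "\<beta> = \<phi> (adj z * y)"
  have ex: "\<phi> (adj (z + scaleC c y) * (z + scaleC c y)) = \<phi> (adj z * z) + (c * \<beta> + cnj c * \<alpha>)" for c
    by (simp add: adj_add adj_scaleC algebra_simps scaleC_mult_left scaleC_mult_right scaleC_scaleC
        add sc 0 \<alpha>_def \<beta>_def)
  have im: "Im (c * \<beta> + cnj c * \<alpha>) = 0" for c
    using pos[of "z + scaleC c y"] pos[of z] unfolding ex by simp
  have bounded_line: "v = 0" if "\<And>t::real. 0 \<le> u + t * v" for u v :: real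
    using that[of "- (u + 1) / v"] by (cases "v = 0") auto
  have "Re (\<beta> + \<alpha>) = 0"
  proof (rule bounded_line)
    show "0 \<le> Re (\<phi> (adj z * z)) + t * Re (\<beta> + \<alpha>)" for t
      using pos[of "z + scaleC (complex_of_real t) y"] unfolding ex by (simp add: algebra_simps)
  qed
  moreover have "Im \<alpha> - Im \<beta> = 0"
  proof (rule bounded_line)
    show "0 \<le> Re (\<phi> (adj z * z)) + t * (Im \<alpha> - Im \<beta>)" for t
      using pos[of "z + scaleC (\<i> * complex_of_real t) y"] unfolding ex by (simp add: algebra_simps)
  qed
  \<comment> \<open>Reality of the values at \<open>c = 1\<close> and \<open>c = \<i>\<close>
    supplies the missing equations.\<close>
  moreover have "Im (\<beta> + \<alpha>) = 0" "Re (\<beta> - \<alpha>) = 0" using im[of 1] im[of \<i>] by simp_all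
  ultimately have "\<alpha> = 0" by (simp add: complex_eq_iff)
  then show ?thesis by (simp add: \<alpha>_def)
qed

section \<open>Strictly positive elements\<close>

text \<open>The least \<open>\<epsilon>\<close> with \<open>b \<le> \<epsilon> + t a\<close> for some \<open>t\<close> is a sublinear function of \<open>b\<close>; a linear functional
  below it is positive and kills \<open>a\<close>.\<close>

lemma strictly_positive_dominates:
  fixes a b :: "'a::cstar_algebra"
  assumes a: "psd a" and b: "psd b" and \<epsilon>: "0 < \<epsilon>"
    and strict: "\<forall>\<phi>::'a \<Rightarrow> complex. positive_functional \<phi> \<and> \<phi> \<noteq> (\<lambda>x. 0) \<longrightarrow> 0 < Re (\<phi> a)"
  shows "\<exists>t\<ge>0. psd (\<epsilon> *\<^sub>R 1 + t *\<^sub>R uembed a - uembed b)"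
proof -
  \<comment> \<open>Using \<open>x + adj x\<close> defines the gauge on all of the algebra and makes
    functionals below it vanish on skew elements; selfadjoint elements get doubled, whence half of
    \<open>b\<close> below. The condition \<open>0 \<le> e\<close> keeps the infimum bounded
    below.\<close>
  define E where "E x = {e. 0 \<le> e \<and> (\<exists>t\<ge>0. psd (e *\<^sub>R 1 + t *\<^sub>R uembed a - uembed (x + adj x)))}" for x
  define q where "q x = Inf (E x)" for x
  have mem: "e \<in> E x" if "0 \<le> e" "0 \<le> t" "psd (e *\<^sub>R 1 + t *\<^sub>R uembed a - uembed (x + adj x))" for e t x
    using that by (auto simp: E_def)
  have bdd: "bdd_below (E x)" for x by (rule bdd_belowI[of _ 0]) (simp add: E_def)
  have q_le: "q x \<le> e" if "e \<in> E x" for x e unfolding q_def using that bdd by (rule cInf_lower)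
  have norm_mem: "2 * norm x \<in> E x" for x
  proof (rule mem[of _ 0])
    have "norm (uembed (x + adj x)) \<le> 2 * norm x"
      using norm_triangle_ineq[of x "adj x"] by simp
    moreover have "adj (uembed (x + adj x)) = uembed (x + adj x)"
      by (simp add: adj_uembed adj_add adj_adj add.commute)
    ultimately show "psd ((2 * norm x) *\<^sub>R 1 + 0 *\<^sub>R uembed a - uembed (x + adj x))"
      using psd_norm_minus by fastforce
  qed auto
  have "sublinear q" unfolding q_def
  proof (rule sublinear_Inf)
    show "E x \<noteq> {}" for x using norm_mem by blast
    fix x y e d assume "e \<in> E x" "d \<in> E y"
    then obtain s t where "0 \<le> e" "0 \<le> d" and st: "0 \<le> s" "0 \<le> t"
      "psd (e *\<^sub>R 1 + s *\<^sub>R uembed a - uembed (x + adj x))"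
      "psd (d *\<^sub>R 1 + t *\<^sub>R uembed a - uembed (y + adj y))" by (auto simp: E_def)
    have "psd ((e + d) *\<^sub>R 1 + (s + t) *\<^sub>R uembed a - uembed ((x + y) + adj (x + y)))"
      using psd_add[OF st(3,4)]
      by (rule back_subst[of psd]) (simp add: unitization_eq_iff adj_add algebra_simps)
    then have "e + d \<in> E (x + y)" using \<open>0 \<le> e\<close> \<open>0 \<le> d\<close> st by (intro mem) auto
    then show "\<exists>c\<in>E (x + y). c \<le> e + d" by blast
  next
    fix t x e assume t: "0 < (t::real)" and "e \<in> E x"
    then obtain s where "0 \<le> e" and s: "0 \<le> s"
      "psd (e *\<^sub>R 1 + s *\<^sub>R uembed a - uembed (x + adj x))" by (auto simp: E_def)
    have "psd ((t * e) *\<^sub>R 1 + (t * s) *\<^sub>R uembed a - uembed (t *\<^sub>R x + adj (t *\<^sub>R x)))"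
      using psd_scaleR[OF less_imp_le[OF t] s(2)]
      by (rule back_subst[of psd]) (simp add: unitization_eq_iff adj_scaleR algebra_simps)
    then have "t * e \<in> E (t *\<^sub>R x)" using \<open>0 \<le> e\<close> t s by (intro mem) auto
    then show "\<exists>c\<in>E (t *\<^sub>R x). c \<le> t * e" by blast
  qed (rule bdd)
  then obtain \<phi> where lin: "linear \<phi>" and \<phi>q: "\<And>x. \<phi> x \<le> q x"
    and \<phi>0: "\<phi> ((1/2) *\<^sub>R b) = q ((1/2) *\<^sub>R b)"
    using Hahn_Banach_sublinear by blast
  note \<phi>_simps = linear_add[OF lin] linear_scale[OF lin] linear_neg[OF lin] linear_diff[OF lin]
  have \<phi>_le: "\<phi> x \<le> e" if "e \<in> E x" for x e using \<phi>q q_le[OF that] order_trans by blast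
  have skew: "\<phi> y = 0" if "adj y = - y" for y
  proof -
    have "\<phi> y \<le> 0" "\<phi> (- y) \<le> 0"
      using that by (intro \<phi>_le mem[of 0 0]; simp add: adj_minus flip: zero_unitization_def)+
    then show ?thesis by (simp add: \<phi>_simps)
  qed
  have pos: "0 \<le> \<phi> p" if "psd p" for p
  proof -
    have "psd (2 *\<^sub>R uembed p)" using that by (intro psd_scaleR) (auto simp: psd_uembed_iff)
    then have "psd (0 *\<^sub>R 1 + 0 *\<^sub>R uembed a - uembed (- p + adj (- p)))"
      by (rule back_subst[of psd])
        (simp add: unitization_eq_iff adj_minus psd_selfadjoint[OF that] scaleR_2)
    then have "\<phi> (- p) \<le> 0" by (intro \<phi>_le mem[of 0 0]) auto
    then show ?thesis by (simp add: \<phi>_simps)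
  qed
  \<comment> \<open>The multiple 2 of \<open>a\<close> cancels \<open>a + adj a\<close>.\<close>
  have "psd (0 *\<^sub>R 1 + 2 *\<^sub>R uembed a - uembed (a + adj a))"
    using psd_zero by (rule back_subst[of psd])
      (simp add: unitization_eq_iff psd_selfadjoint[OF a] scaleR_2)
  then have \<phi>a: "\<phi> a \<le> 0" by (intro \<phi>_le mem[of 0 2]) auto
  have bound: "\<bar>\<phi> x\<bar> \<le> 2 * norm x" for x
    using \<phi>_le[OF norm_mem, of x] \<phi>_le[OF norm_mem, of "- x"] by (simp add: \<phi>_simps abs_le_iff)
  \<comment> \<open>The complex-linear functional with real part \<open>\<phi>\<close>; it is real
    on positive \<open>p\<close> because \<open>scaleC \<i> p\<close> is skew.\<close>
  define \<Phi> where "\<Phi> x = Complex (\<phi> x) (- \<phi> (scaleC \<i> x))" for x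
  have sc: "scaleC c x = Re c *\<^sub>R x + Im c *\<^sub>R scaleC \<i> x" for c and x :: 'a
    by (subst complex_eq[of c]) (simp add: scaleC_add_left scaleR_scaleC scaleC_scaleC mult.commute)
  have ii: "scaleC \<i> (scaleC \<i> x) = - x" for x :: 'a by (simp add: scaleC_scaleC scaleC_minus_one)
  have \<Phi>_add: "\<Phi> (x + y) = \<Phi> x + \<Phi> y" for x y
    by (simp add: \<Phi>_def complex_eq_iff scaleC_add_right \<phi>_simps)
  have \<Phi>_scale: "\<Phi> (scaleC c x) = c * \<Phi> x" for c x
  proof -
    have "scaleC \<i> (scaleC c x) = scaleC c (scaleC \<i> x)" by (simp add: scaleC_scaleC mult.commute)
    also have "\<dots> = Re c *\<^sub>R scaleC \<i> x - Im c *\<^sub>R x" by (subst sc) (simp add: ii)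
    finally show ?thesis
      by (simp add: \<Phi>_def complex_eq_iff sc[of c x] \<phi>_simps)
  qed
  have "bounded_linear \<Phi>"
  proof (rule bounded_linear_intro[of _ 4])
    show "\<Phi> (r *\<^sub>R x) = r *\<^sub>R \<Phi> x" for r x
      by (simp add: scaleR_scaleC \<Phi>_scale scaleR_conv_of_real)
    show "norm (\<Phi> x) \<le> norm x * 4" for x
      using cmod_le[of "\<Phi> x"] bound[of x] bound[of "scaleC \<i> x"] by (simp add: \<Phi>_def norm_scaleC)
  qed (rule \<Phi>_add)
  then have "\<Phi> \<in> cdual"
    using \<Phi>_add \<Phi>_scale by (simp add: cdual_def clinear_functional_def linear_continuous_on)
  moreover have "\<phi> (scaleC \<i> p) = 0" if "psd p" for p
    using psd_selfadjoint[OF that] scaleC_scaleC[of "-1" \<i> p]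
    by (intro skew) (simp add: adj_scaleC scaleC_minus_one)
  ultimately have "positive_functional \<Phi>"
    using pos by (simp add: positive_functional_def positive_iff_psd \<Phi>_def)
  moreover have "\<not> 0 < Re (\<Phi> a)" using \<phi>a by (simp add: \<Phi>_def)
  \<comment> \<open>Strictness leaves only the zero functional, so the gauge of half of
    \<open>b\<close> is 0 and some admissible \<open>e\<close> lies below
    \<open>\<epsilon>\<close>.\<close>
  ultimately have "\<Phi> = (\<lambda>x. 0)" using strict by blast
  then have "\<Phi> ((1/2) *\<^sub>R b) = 0" by simp
  then have "q ((1/2) *\<^sub>R b) = 0" using \<phi>0 by (simp add: \<Phi>_def complex_eq_iff)
  then obtain e where e: "e \<in> E ((1/2) *\<^sub>R b)" "e < \<epsilon>"
    using cInf_lessD[of "E ((1/2) *\<^sub>R b)" \<epsilon>] norm_mem \<epsilon> unfolding q_def by auto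
  have bb: "(1/2) *\<^sub>R b + adj ((1/2) *\<^sub>R b) = b"
    using scaleR_half_double[of b] by (simp add: adj_scaleR psd_selfadjoint[OF b] scaleR_add_right)
  obtain t where t: "0 \<le> t" "psd (e *\<^sub>R 1 + t *\<^sub>R uembed a - uembed b)"
    using e(1) unfolding E_def bb by blast
  have "psd (1::'a unitization)" using psd_square[of "1::'a unitization"] by simp
  then have "psd ((\<epsilon> - e) *\<^sub>R (1::'a unitization))" using e(2) by (intro psd_scaleR) auto
  from psd_add[OF t(2) this] have "psd (\<epsilon> *\<^sub>R 1 + t *\<^sub>R uembed a - uembed b)"
    by (simp add: algebra_simps)
  then show ?thesis using t(1) by blast
qed

text \<open>Conjugating the domination of \<open>adj x * x\<close> by \<open>d\<close> bounds the
  square of \<open>norm (uembed x * d)\<close> by \<open>\<epsilon>\<close> plus a multiple of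
  \<open>norm (d * C * d)\<close>, which is of order \<open>1/k\<close> by the Bernoulli
  estimate.\<close>

lemma strictly_positive_approximate_unit:
  fixes a x :: "'a::cstar_algebra"
  assumes a: "psd a" and M: "0 < M" "norm a \<le> M"
    and strict: "\<forall>\<phi>::'a \<Rightarrow> complex. positive_functional \<phi> \<and> \<phi> \<noteq> (\<lambda>x. 0) \<longrightarrow> 0 < Re (\<phi> a)"
  shows "(\<lambda>k. uembed x * (1 - (1/M) *\<^sub>R uembed a) ^ k) \<longlonglongrightarrow> 0"
proof (rule LIMSEQ_I)
  fix e :: real assume e: "0 < e"
  define C where "C = (1/M) *\<^sub>R uembed a"
  have C: "psd C" "norm C \<le> 1"
    using a M by (auto simp: C_def psd_uembed_iff intro!: psd_scaleR)
  \<comment> \<open>The two error terms below are at most \<open>\<epsilon>\<close> each, so their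
    sum stays under the square of \<open>e\<close>.\<close>
  define \<epsilon> where "\<epsilon> = e\<^sup>2 / 4"
  have \<epsilon>: "0 < \<epsilon>" using e by (simp add: \<epsilon>_def)
  have "positive (adj x * x)" by (auto simp: positive_def)
  then have "psd (adj x * x)" by (simp add: positive_iff_psd)
  from strictly_positive_dominates[OF a this \<epsilon> strict] obtain t where t: "0 \<le> t"
    "psd (\<epsilon> *\<^sub>R 1 + t *\<^sub>R uembed a - uembed (adj x * x))" by blast
  obtain K :: nat where K: "t * M / \<epsilon> < real K" using reals_Archimedean2 by blast
  show "\<exists>K. \<forall>k\<ge>K. norm (uembed x * (1 - (1/M) *\<^sub>R uembed a) ^ k - 0) < e"
  proof (intro exI allI impI)
    fix k assume k: "K \<le> k"
    define d where "d = (1 - C) ^ k"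
    have adj_pow: "adj ((1 - C) ^ j) = (1 - C) ^ j" for j
      by (induction j) (simp_all add: adj_mult adj_diff psd_selfadjoint[OF C(1)] power_commutes)
    have ad: "adj d = d" by (simp add: d_def adj_pow)
    have "norm d \<le> norm (1 - C) ^ k" unfolding d_def by (rule norm_power_ineq)
    also have "\<dots> \<le> 1" using norm_one_minus_psd_le[OF C] by (intro power_le_one) auto
    finally have nd: "norm d \<le> 1" .
    have cd: "d * C = C * d" unfolding d_def by (rule power_commuting_commutes) (simp add: algebra_simps)
    have "d * C * d = C * (1 - C) ^ (2 * k)"
      by (simp add: cd mult.assoc) (simp add: d_def mult_2 power_add)
    then have "real (2 * k) * norm (d * C * d) \<le> 1"
      using norm_mult_power_one_minus_le[OF C, of "2 * k"] by simp
    moreover have "real K * norm (d * C * d) \<le> real (2 * k) * norm (d * C * d)"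
      using k by (intro mult_right_mono) auto
    ultimately have nK: "real K * norm (d * C * d) \<le> 1" by linarith
    have tA: "t *\<^sub>R (d * uembed a * d) = (t * M) *\<^sub>R (d * C * d)" using M by (simp add: C_def)
    have small: "t * M * norm (d * C * d) \<le> \<epsilon>"
    proof -
      have "t * M \<le> \<epsilon> * real K" using K \<epsilon> by (simp add: field_simps)
      then have "t * M * norm (d * C * d) \<le> \<epsilon> * real K * norm (d * C * d)"
        by (rule mult_right_mono) simp
      also have "\<dots> \<le> \<epsilon> * 1"
        using mult_left_mono[OF nK less_imp_le[OF \<epsilon>]] by (simp only: mult.assoc)
      finally show ?thesis by simp
    qed
    have eq: "adj (uembed x * d) * (uembed x * d) = d * uembed (adj x * x) * d"
      by (simp add: adj_mult ad adj_uembed mult.assoc flip: mult_uembed)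
    have "psd (d * (\<epsilon> *\<^sub>R 1 + t *\<^sub>R uembed a - uembed (adj x * x)) * d)"
      using psd_conjugate[OF t(2), of d] by (simp add: ad)
    then have "psd ((\<epsilon> *\<^sub>R (d * d) + t *\<^sub>R (d * uembed a * d)) - d * uembed (adj x * x) * d)"
      by (simp add: algebra_simps)
    moreover have "psd (d * uembed (adj x * x) * d)" unfolding eq[symmetric] by (rule psd_adj_mult_self)
    ultimately have "(norm (uembed x * d))\<^sup>2 \<le> norm (\<epsilon> *\<^sub>R (d * d) + (t * M) *\<^sub>R (d * C * d))"
      unfolding tA[symmetric] by (metis norm_psd_mono eq cstar_identity)
    also have "\<dots> \<le> \<epsilon> * norm (d * d) + t * M * norm (d * C * d)"
      using norm_triangle_ineq[of "\<epsilon> *\<^sub>R (d * d)" "(t * M) *\<^sub>R (d * C * d)"] \<epsilon> t M by simp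
    also have "\<dots> \<le> \<epsilon> * 1 + \<epsilon>"
    proof (intro add_mono mult_left_mono small)
      show "norm (d * d) \<le> 1"
        using norm_mult_ineq[of d d] mult_mono[OF nd nd] by (simp add: order_trans)
    qed (use \<epsilon> in simp)
    also have "\<dots> < e\<^sup>2" using e by (simp add: \<epsilon>_def)
    finally have "norm (uembed x * d) < e" using e by (simp add: power_less_imp_less_base)
    then show "norm (uembed x * (1 - (1/M) *\<^sub>R uembed a) ^ k - 0) < e" by (simp add: d_def C_def)
  qed
qed

text \<open>The compressions of \<open>x\<close> by \<open>1 - d k\<close> converge to
  \<open>x\<close> and have the form \<open>r * z * r\<close>, where \<open>f\<close> vanishes;
  continuity finishes.\<close>

lemma functional_vanishes_if_strictly_positive:
  fixes r :: "'a::cstar_algebra"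
  assumes r: "adj r = r" and f: "f \<in> cdual" and fr: "\<And>x. f (r * x * r) = 0"
    and strict: "\<forall>\<phi>::'a \<Rightarrow> complex. positive_functional \<phi> \<and> \<phi> \<noteq> (\<lambda>x. 0) \<longrightarrow> 0 < Re (\<phi> (r * r))"
  shows "f x = 0"
proof -
  define M where "M = norm (r * r) + 1"
  have M: "0 < M" "norm (r * r) \<le> M" by (simp_all add: M_def add_nonneg_pos)
  define C where "C = (1/M) *\<^sub>R uembed (r * r)"
  define d where "d k = (1 - C) ^ k" for k
  have C: "psd C" "norm C \<le> 1"
    using M psd_square[OF r] by (auto simp: C_def psd_uembed_iff intro!: psd_scaleR)
  have lim: "(\<lambda>k. uembed y * d k) \<longlonglongrightarrow> 0" for y
    unfolding d_def C_def by (rule strictly_positive_approximate_unit[OF psd_square[OF r] M strict])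
  have ad: "adj (d k) = d k" for k unfolding d_def
    by (induction k) (simp_all add: adj_mult adj_diff psd_selfadjoint[OF C(1)] power_commutes)
  have nd: "norm (d k) \<le> 1" for k
    using norm_power_ineq[of "1 - C" k] power_le_one[OF _ norm_one_minus_psd_le[OF C], of k]
    unfolding d_def by (simp add: order_trans)
  have "(\<lambda>k. adj (uembed (adj x) * d k)) \<longlonglongrightarrow> adj 0"
    by (rule bounded_linear.tendsto[OF bounded_linear_adj lim])
  then have lim': "(\<lambda>k. d k * uembed x) \<longlonglongrightarrow> 0" by (simp add: adj_mult ad adj_uembed adj_adj)
  have "(\<lambda>k. d k * uembed x * d k) \<longlonglongrightarrow> 0"
  proof (rule tendsto_0_le[OF lim', of _ 1], rule always_eventually, rule allI)
    fix k
    show "norm (d k * uembed x * d k) \<le> norm (d k * uembed x) * 1"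
      using nd[of k] by (intro order_trans[OF norm_mult_ineq] mult_left_mono) auto
  qed
  then have "(\<lambda>k. uembed x - d k * uembed x - uembed x * d k + d k * uembed x * d k)
      \<longlonglongrightarrow> uembed x - 0 - 0 + 0"
    by (intro tendsto_intros lim lim')
  then have conv: "(\<lambda>k. (1 - d k) * uembed x * (1 - d k)) \<longlonglongrightarrow> uembed x"
    by (simp add: algebra_simps)
  \<comment> \<open>Each step adds \<open>C * d k\<close>, and \<open>C\<close> is a multiple of
    \<open>uembed r * uembed r\<close>.\<close>
  have "\<exists>G. 1 - d k = uembed r * G" for k
  proof (induction k)
    case (Suc k)
    then obtain G where "1 - d k = uembed r * G" by blast
    then have "1 - d (Suc k) = uembed r * (G + (1/M) *\<^sub>R (uembed r * d k))"
      by (simp add: d_def C_def algebra_simps flip: mult_uembed)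
    then show ?case by blast
  qed (auto simp: d_def intro: exI[of _ 0])
  then obtain G where G: "\<And>k. 1 - d k = uembed r * G k" by metis
  have "1 - d k = adj (G k) * uembed r" for k
    using arg_cong[OF G[of k], of adj] by (simp add: adj_mult adj_diff ad adj_uembed r)
  then have fact: "(1 - d k) * uembed x * (1 - d k) =
      uembed r * (G k * uembed x * adj (G k)) * uembed r" for k
    using G[of k] by (metis mult.assoc)
  define y where "y k = r * alg_part (G k * uembed x * adj (G k)) * r" for k
  \<comment> \<open>The original algebra is an ideal: the factor \<open>uembed x\<close> kills the
    scalar part.\<close>
  have "G k * uembed x * adj (G k) = uembed (alg_part (G k * uembed x * adj (G k)))" for k
    by (simp add: unitization_eq_iff)
  then have uy: "(1 - d k) * uembed x * (1 - d k) = uembed (y k)" for k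
    unfolding fact y_def mult_uembed[symmetric] by metis
  have "(\<lambda>k. norm (uembed (y k) - uembed x)) \<longlonglongrightarrow> 0"
    using conv unfolding uy by (simp only: tendsto_norm_zero_iff LIM_zero_iff)
  moreover have "norm (uembed (y k) - uembed x) = norm (y k - x)" for k
    using norm_uembed[of "y k - x"] by (simp add: minus_unitization_def)
  ultimately have "y \<longlonglongrightarrow> x" by (simp add: tendsto_norm_zero_iff LIM_zero_iff)
  moreover have "isCont f x"
    using f by (simp add: cdual_def continuous_on_eq_continuous_at)
  ultimately have "(\<lambda>k. f (y k)) \<longlonglongrightarrow> f x" by (rule isCont_tendsto_compose[rotated])
  then show ?thesis by (simp add: y_def fr LIMSEQ_const_iff)
qed

theorem theorem15:
  fixes a :: "'a::cstar_algebra"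
  assumes "positive a"
  shows "is_norm_on cdual (\<lambda>f. dual_norm (\<lambda>x. f (pos_sqrt a * x * pos_sqrt a)))
     \<longleftrightarrow> (\<forall>\<phi>. positive_functional \<phi> \<and> \<phi> \<noteq> (\<lambda>x. 0) \<longrightarrow> Im (\<phi> a) = 0 \<and> 0 < Re (\<phi> a))"
proof -
  define r where "r = pos_sqrt a"
  have r: "adj r = r" "r * r = a"
    using pos_sqrt[OF assms] by (simp_all add: r_def psd_selfadjoint)
  show ?thesis unfolding r_def[symmetric] is_norm_on_conjugate_iff
  proof (intro iffI allI impI ballI)
    fix \<phi> :: "'a \<Rightarrow> complex"
    assume inj: "\<forall>f\<in>cdual. (\<forall>x. f (r * x * r) = 0) \<longrightarrow> f = (\<lambda>x. 0)"
      and \<phi>: "positive_functional \<phi> \<and> \<phi> \<noteq> (\<lambda>x. 0)"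
    have pos: "Im (\<phi> a) = 0" "0 \<le> Re (\<phi> a)"
      using \<phi> assms by (auto simp: positive_functional_def)
    have "Re (\<phi> a) \<noteq> 0"
    proof
      assume "Re (\<phi> a) = 0"
      then have "\<phi> (adj r * r) = 0" using pos r by (simp add: complex_eq_iff)
      \<comment> \<open>Degenerate Cauchy--Schwarz with \<open>y = r\<close> and
        \<open>z = x * r\<close>.\<close>
      then have "\<phi> (r * x * r) = 0" for x
        using positive_functional_vanish[of \<phi> r "x * r"] \<phi> r(1) by (simp add: mult.assoc)
      then show False using inj \<phi> by (auto simp: positive_functional_def)
    qed
    then show "Im (\<phi> a) = 0 \<and> 0 < Re (\<phi> a)" using pos by simp
  next
    fix f :: "'a \<Rightarrow> complex"
    assume "\<forall>\<phi>. positive_functional \<phi> \<and> \<phi> \<noteq> (\<lambda>x. 0) \<longrightarrow> Im (\<phi> a) = 0 \<and> 0 < Re (\<phi> a)"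
      and "f \<in> cdual" "\<forall>x. f (r * x * r) = 0"
    then show "f = (\<lambda>x. 0)"
      using functional_vanishes_if_strictly_positive[OF r(1), of f] by (auto simp: r(2))
  qed
qed

end
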